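(* Let $n\ge 1$. Let $S_1,\dots,S_n$ be mutually independent random variables with values in $(0,1)$, with distribution functions $G_1,\dots,G_n$, and independent of a random variable $R$ with distribution function $F$. Assume that $F(0-)=0$ and that the upper endpoint satisfies $r_F\in(0,\infty]$. Assume also that for every $i\le n$ there is $\alpha_i\in[0,\infty)$ with $$\lim_{u\to\infty}\frac{\overline G_i(1-x/u)}{\overline G_i(1-1/u)}=x^{\alpha_i},\qquad \forall x>0 .$$ Put $X_n=R\prod_{i=1}^n S_i$ and let $H_n$ be the distribution function of $X_n$. (a) If $F\in \mathrm{MDA}(\Lambda,w)$ with $r_F\in(0,\infty]$, then $$\mathbf P\{X_n>u\}\sim \prod_{i=1}^n\Bigl[\Gamma(\alpha_i+1)\,\overline G_i\Bigl(1-\frac1{u\,w(u)}\Bigr)\Bigr]\overline F(u),\qquad u\uparrow r_F .$$ (a1) If, in addition to the assumptions of (a), $r_F=\infty$, $\lim_{u\to\infty}w(u)=0$, and $$\lim_{u\to\infty}\frac1{\overline F(u)}\int_{\lambda/w(u)}^{u-\lambda/w(u)}\overline F(u-y)\,dF(y)=0\quad\text{for some }\lambda>0,$$ then $H_n\in\mathcal S_+$. (b) If $F\in\mathrm{MDA}(\Psi_\gamma)$ with $\gamma\in[0,\infty)$ and $r_F=1$, then $$\mathbf P\{X_n>u\}\sim\frac{\Gamma(\gamma+1)}{\Gamma\bigl(\gamma+\sum_{i=1}^n\alpha_i+1\bigr)}\prod_{i=1}^n\bigl[\Gamma(\alpha_i+1)\,\overline G_i(u)\bigr]\overline F(u),\qquad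 u\uparrow 1 .$$
   Context: For a distribution function $F$, $\overline F=1-F$, and $r_F=\sup\{x:F(x)<1\}$ is its upper endpoint. $\Gamma$ is the Euler gamma function. $a(u)\sim b(u)$ means that $a(u)/b(u)\to1$ in the indicated limit. $F\in\mathrm{MDA}(\Lambda,w)$ (Gumbel max-domain of attraction with scaling function $w$) means that $w$ is a positive function with $$\lim_{u\uparrow r_F}\frac{\overline F(u+x/w(u))}{\overline F(u)}=e^{-x},\quad\forall x\in\mathbb R,$$ and $\lim_{u\uparrow r_F}u\,w(u)=\infty$, and, if $r_F<\infty$, $\lim_{u\uparrow r_F}w(u)(r_F-u)=\infty$. $F\in\mathrm{MDA}(\Psi_\gamma)$ (Weibull max-domain of attraction) means that $r_F<\infty$ and $$\lim_{u\to\infty}\frac{\overline F(r_F-x/u)}{\overline F(r_F-1/u)}=x^\gamma,\quad\forall x>0;$$ for $\gamma=0$ the notation stands for this same limit relation with $\gamma=0$. In the Weibull case the paper's convention is $r_F=1$. $\mathcal S_+$ is the class of subexponential distribution functions $F$ with $F(0-)=0$ and $r_F=\infty$, i.e. those with $\lim_{u\to\infty}\overline{F^{2*}}(u)/\overline F(u)=2$, where $F^{2*}$ is the distribution function of $R+R^*$ with $R,R^*$ independent with distribution function $F$. Lebesgue–Stieltjes integrals $\int_a^b$ are over $(a,b]$. *)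

theory Defs
  imports "HOL-Probability.Probability"
begin

definition tail :: "(real \<Rightarrow> real) \<Rightarrow> real \<Rightarrow> real"
  where "tail F x = 1 - F x"

definition upper_endpoint :: "(real \<Rightarrow> real) \<Rightarrow> ereal"
  where "upper_endpoint F = (SUP x\<in>{x. F x < 1}. ereal x)"

text \<open>The filter for a real variable increasing to a possibly infinite endpoint.
  It is only meant for \<^term>\<open>r > -\<infinity>\<close>, which always holds for the upper endpoint of a
  distribution function.\<close>

definition up_to :: "ereal \<Rightarrow> real filter"
  where "up_to r = (if r = \<infinity> then at_top else at_left (real_of_ereal r))"

definition MDA_Gumbel :: "(real \<Rightarrow> real) \<Rightarrow> (real \<Rightarrow> real) \<Rightarrow> bool"
  where "MDA_Gumbel F w \<longleftrightarrow>
    (\<forall>u. ereal u < upper_endpoint F \<longrightarrow> 0 < w u) \<and>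
    (\<forall>x. ((\<lambda>u. tail F (u + x / w u) / tail F u) \<longlongrightarrow> exp (- x)) (up_to (upper_endpoint F))) \<and>
    filterlim (\<lambda>u. u * w u) at_top (up_to (upper_endpoint F)) \<and>
    (upper_endpoint F < \<infinity> \<longrightarrow>
      filterlim (\<lambda>u. w u * (real_of_ereal (upper_endpoint F) - u)) at_top
        (up_to (upper_endpoint F)))"

definition MDA_Weibull :: "(real \<Rightarrow> real) \<Rightarrow> real \<Rightarrow> bool"
  where "MDA_Weibull F \<gamma> \<longleftrightarrow>
    upper_endpoint F < \<infinity> \<and>
    (\<forall>x>0. ((\<lambda>u. tail F (real_of_ereal (upper_endpoint F) - x / u) /
                  tail F (real_of_ereal (upper_endpoint F) - 1 / u)) \<longlongrightarrow> x powr \<gamma>) at_top)"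

text \<open>The law \<open>N\<close> is determined by its distribution function (\<open>cdf_unique\<close>), and
  \<open>N \<star> N\<close> is the law of the sum of two independent random variables with law \<open>N\<close>.\<close>

definition subexponential_pos :: "(real \<Rightarrow> real) set"  ("\<S>\<^sub>+")
  where "\<S>\<^sub>+ = {F. \<exists>N. real_distribution N \<and> F = cdf N \<and>
    (F \<longlongrightarrow> 0) (at_left 0) \<and> upper_endpoint F = \<infinity> \<and>
    ((\<lambda>u. tail (cdf (N \<star> N)) u / tail F u) \<longlongrightarrow> 2) at_top}"

end

theory Submission
  imports Defs
begin

text \<open>
  Write \<open>T\<close> for the product of the \<open>S i\<close>.  Conditioning on \<open>T\<close>, the tail of \<open>R * T\<close> at \<open>u\<close> is the mean of
  \<open>tail F (u / T)\<close>, and only values of \<open>T\<close> close to \<open>1\<close> matter.  On the right scale \<open>1 - T\<close> has an asymptotic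
  distribution function \<open>x powr \<alpha>\<close>, while \<open>tail F (u / T) / tail F u\<close> becomes an explicit decreasing
  function \<open>f\<close> of the rescaled \<open>1 - T\<close>: \<open>exp (- x)\<close> in the Gumbel case, \<open>(1 - x) powr \<gamma>\<close> on \<open>(0, 1)\<close> in the
  Weibull case.  The limit constant is the integral of \<open>f\<close> with respect to \<open>x powr \<alpha>\<close>, computed as the
  integral of \<open>q y powr \<alpha>\<close> over the levels \<open>y\<close> in \<open>(0, 1)\<close>, where \<open>q\<close> is the inverse of \<open>f\<close>
  (\<open>regular_variation_integral_limit\<close>).  This gives a Gamma function (\<open>product_tail_gumbel\<close>) or a
  Beta function (\<open>product_tail_regularly_varying\<close>).  In the Gumbel case the domination comes from two power
  bounds: the tail of \<open>T\<close> at \<open>1 - x / s\<close> grows at most polynomially in \<open>x\<close>, and the tail of \<open>R\<close> decays faster than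
  any power on the scale \<open>1 / w u\<close>, because this scale is self-neglecting.

  The second product formula, applied repeatedly, also describes \<open>T\<close> itself
  (\<open>tail_prod_regularly_varying\<close>): its tail at \<open>1\<close> is regularly varying with index \<open>a = sum \<alpha>\<close>, and the
  constants telescope to \<open>prod Gamma (\<alpha> i + 1) / Gamma (a + 1)\<close>.  So for each of the asymptotic formulas it is enough
  to treat \<open>R * T\<close> with two factors, and \<open>Gamma (a + 1)\<close> cancels.

  For subexponentiality, split the event that the sum of two copies exceeds \<open>u\<close> at the threshold
  \<open>l / w u\<close>.  If one summand lies below the threshold, the asymptotics of the tail of \<open>R * T\<close> give the
  contribution \<open>1\<close> for each summand (\<open>convolution_tail_limit\<close>).  If both lie above it, then, as
  \<open>R * T + R' * T' \<le> (R + R') * max T T'\<close>, the probability is at most twice that of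
  \<open>R, R' > l / w u\<close> and \<open>(R + R') * T > u\<close>.  The integral condition makes this event for \<open>R\<close> and \<open>R'\<close> alone
  negligible compared with \<open>tail F v\<close>, uniformly in the levels \<open>v = u / T \<ge> u\<close>
  (\<open>both_large_uniform\<close>), and the mean of \<open>tail F (u / T)\<close> is the tail of \<open>R * T\<close>
  (\<open>both_large_product_law\<close>).
\<close>

section \<open>Limits at an upper endpoint\<close>

text \<open>Both kinds of endpoint filter are countably generated, so limits may be tested on sequences.
  This is what makes dominated convergence available along \<^const>\<open>up_to\<close>.\<close>

lemma tendsto_up_to_sequentially:
  assumes "r \<noteq> - \<infinity>"
    and "\<And>X. filterlim X (up_to r) sequentially \<Longrightarrow> (\<lambda>n. f (X n)) \<longlonglongrightarrow> L"
  shows "(f \<longlongrightarrow> (L::real)) (up_to r)"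
proof (cases "r = \<infinity>")
  case True
  then show ?thesis
    using assms(2) by (auto simp: up_to_def intro!: tendsto_at_topI_sequentially)
next
  case False
  let ?r = "real_of_ereal r"
  have "(f \<longlongrightarrow> L) (at_left ?r)"
  proof (rule tendsto_at_left_sequentially[of "?r - 1"])
    fix S :: "nat \<Rightarrow> real"
    assume S: "\<And>n. S n < ?r" "S \<longlonglongrightarrow> ?r"
    have "filterlim S (at_left ?r) sequentially"
      using S(2) S(1)[THEN less_imp_neq] S(1) by (auto simp: filterlim_at)
    then show "(\<lambda>n. f (S n)) \<longlonglongrightarrow> L"
      using assms(2) False by (simp add: up_to_def)
  qed simp
  then show ?thesis
    using False by (simp add: up_to_def)
qed

lemma eventually_up_to:
  assumes "r \<noteq> - \<infinity>"
  shows "eventually P (up_to r) \<longleftrightarrow> (\<exists>a. ereal a < r \<and> (\<forall>x. a < x \<and> ereal x < r \<longrightarrow> P x))"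
proof (cases r)
  case (real b)
  then show ?thesis
    by (auto simp: up_to_def eventually_at_left[of "b - 1"])
next
  case PInf
  then show ?thesis by (auto simp: up_to_def eventually_at_top_dense)
qed (use assms in auto)

lemma filterlim_up_toI:
  assumes "r \<noteq> - \<infinity>"
    and "eventually (\<lambda>x. ereal (f x) < r) A"
    and "\<And>a. ereal a < r \<Longrightarrow> eventually (\<lambda>x. a < f x) A"
  shows "filterlim f (up_to r) A"
  unfolding filterlim_iff
proof (intro allI impI)
  fix P assume "eventually P (up_to r)"
  then obtain a where a: "ereal a < r" "\<And>x. a < x \<Longrightarrow> ereal x < r \<Longrightarrow> P x"
    using eventually_up_to[OF assms(1)] by blast
  show "eventually (\<lambda>x. P (f x)) A"
    using assms(2) assms(3)[OF a(1)] by eventually_elim (use a in auto)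
qed

text \<open>Monotonicity in the argument turns pointwise convergence into convergence along every
  convergent sequence of arguments, by squeezing between two fixed arguments.\<close>

lemma mono_tendsto_moving_argument:
  fixes g :: "'b \<Rightarrow> real \<Rightarrow> real" and h :: "real \<Rightarrow> real"
  assumes mono: "eventually (\<lambda>n. mono_on {a<..} (g n)) A"
    and lim: "\<And>x. a < x \<Longrightarrow> ((\<lambda>n. g n x) \<longlongrightarrow> h x) A"
    and cont: "isCont h x0" and "a < x0"
    and xi: "(\<xi> \<longlongrightarrow> x0) A"
  shows "((\<lambda>n. g n (\<xi> n)) \<longlongrightarrow> h x0) A"
proof (rule order_tendstoI)
  fix y assume "h x0 > y"
  then have "eventually (\<lambda>x. h x > y) (at x0)"
    using cont unfolding isCont_def by (rule order_tendstoD(1)[rotated])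
  then have "eventually (\<lambda>x. h x > y) (at_left x0)"
    by (rule filter_leD[OF at_le, rotated]) simp
  then obtain b where b: "b < x0" "\<And>x. b < x \<Longrightarrow> x < x0 \<Longrightarrow> h x > y"
    using eventually_at_left[of "x0 - 1" x0] by auto
  obtain x where x: "max a b < x" "x < x0"
    using b(1) \<open>a < x0\<close> dense[of "max a b" x0] by auto
  have "eventually (\<lambda>n. g n x > y) A"
    using order_tendstoD(1)[OF lim b(2)] x by auto
  moreover have "eventually (\<lambda>n. \<xi> n > x) A"
    using order_tendstoD(1)[OF xi] x by auto
  ultimately show "eventually (\<lambda>n. g n (\<xi> n) > y) A"
    using mono
  proof eventually_elim
    case (elim n)
    have "g n x \<le> g n (\<xi> n)"
      using elim x by (intro mono_onD[OF elim(3)]) auto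
    with elim show ?case by linarith
  qed
next
  fix y assume "h x0 < y"
  then have "eventually (\<lambda>x. h x < y) (at x0)"
    using cont unfolding isCont_def by (rule order_tendstoD(2)[rotated])
  then have "eventually (\<lambda>x. h x < y) (at_right x0)"
    by (rule filter_leD[OF at_le, rotated]) simp
  then obtain b where b: "x0 < b" "\<And>x. x0 < x \<Longrightarrow> x < b \<Longrightarrow> h x < y"
    using eventually_at_right[of x0 "x0 + 1"] by auto
  obtain x where x: "x0 < x" "x < b"
    using b(1) dense by auto
  have "eventually (\<lambda>n. g n x < y) A"
    using order_tendstoD(2)[OF lim b(2)] x \<open>a < x0\<close> by auto
  moreover have "eventually (\<lambda>n. \<xi> n < x) A" "eventually (\<lambda>n. a < \<xi> n) A"
    using order_tendstoD[OF xi] x \<open>a < x0\<close> by auto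
  ultimately show "eventually (\<lambda>n. g n (\<xi> n) < y) A"
    using mono
  proof eventually_elim
    case (elim n)
    have "g n (\<xi> n) \<le> g n x"
      using elim x by (intro mono_onD[OF elim(4)]) auto
    with elim show ?case by linarith
  qed
qed

lemma antimono_tendsto_moving_argument:
  fixes g :: "'b \<Rightarrow> real \<Rightarrow> real" and h :: "real \<Rightarrow> real"
  assumes "eventually (\<lambda>n. antimono (g n)) A"
    and "\<And>x. ((\<lambda>n. g n x) \<longlongrightarrow> h x) A"
    and "isCont h x0"
    and "(\<xi> \<longlongrightarrow> x0) A"
  shows "((\<lambda>n. g n (\<xi> n)) \<longlongrightarrow> h x0) A"
proof -
  have "((\<lambda>n. - g n (\<xi> n)) \<longlongrightarrow> - h x0) A"
    by (rule mono_tendsto_moving_argument[where a = "x0 - 1" and g = "\<lambda>n x. - g n x" and h = "\<lambda>x. - h x"])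
       (use assms in \<open>auto intro!: tendsto_minus isCont_minus elim!: eventually_mono
          simp: mono_on_def monotone_def\<close>)
  then show ?thesis
    by (simp add: tendsto_minus_cancel_left)
qed

section \<open>Tails and regular variation at one\<close>

lemma (in real_distribution) tail_cdf: "tail (cdf M) x = measure M {x<..}"
proof -
  have "measure M (space M - {..x}) = 1 - measure M {..x}"
    by (rule prob_compl) simp
  moreover have "space M - {..x} = {x<..}" by (auto simp: borel_UNIV)
  ultimately show ?thesis by (simp add: tail_def cdf_def)
qed

lemma (in real_distribution)
  shows tail_nonneg: "0 \<le> tail (cdf M) x"
    and tail_le_1: "tail (cdf M) x \<le> 1"
    and tail_antimono: "x \<le> y \<Longrightarrow> tail (cdf M) y \<le> tail (cdf M) x"
  using cdf_nonneg[of x] cdf_bounded_prob[of x] cdf_nondecreasing[of x y]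
  by (auto simp: tail_def)

lemma (in real_distribution) borel_measurable_tail [measurable]:
  "tail (cdf M) \<in> borel_measurable borel"
proof -
  have "cdf M \<in> borel_measurable borel"
    by (rule borel_measurable_mono) (auto simp: mono_def cdf_nondecreasing)
  then show ?thesis by (simp add: tail_def[abs_def])
qed

lemma upper_endpoint_le_iff: "upper_endpoint F \<le> ereal b \<longleftrightarrow> (\<forall>x>b. 1 \<le> F x)"
  by (auto simp: upper_endpoint_def SUP_le_iff not_le[symmetric])

text \<open>Equivalently, \<open>u \<mapsto> tail G (1 - 1 / u)\<close> is regularly varying at infinity with index \<open>- \<alpha>\<close>.\<close>

definition tail_regularly_varying_at_1 :: "(real \<Rightarrow> real) \<Rightarrow> real \<Rightarrow> bool"
  where "tail_regularly_varying_at_1 G \<alpha> \<longleftrightarrow>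
    (\<forall>x>0. ((\<lambda>u. tail G (1 - x / u) / tail G (1 - 1 / u)) \<longlongrightarrow> x powr \<alpha>) at_top)"

text \<open>The uniform convergence theorem for regular variation, in the form used below.  For tails it is
  elementary, since they are monotone and the limit is continuous.\<close>

lemma (in real_distribution) tail_regularly_varying_at_1_moving:
  assumes rv: "tail_regularly_varying_at_1 (cdf M) \<alpha>"
    and s: "filterlim s at_top A" and xi: "(\<xi> \<longlongrightarrow> x) A" and "0 < x"
  shows "((\<lambda>n. tail (cdf M) (1 - \<xi> n / s n) / tail (cdf M) (1 - 1 / s n)) \<longlongrightarrow> x powr \<alpha>) A"
proof (rule mono_tendsto_moving_argument[where a = 0 and \<xi> = \<xi> and h = "\<lambda>x. x powr \<alpha>"
      and g = "\<lambda>n x. tail (cdf M) (1 - x / s n) / tail (cdf M) (1 - 1 / s n)"])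
  have "eventually (\<lambda>n. s n > 0) A"
    using s by (simp add: filterlim_at_top_dense)
  then show "eventually (\<lambda>n. mono_on {0<..}
      (\<lambda>x. tail (cdf M) (1 - x / s n) / tail (cdf M) (1 - 1 / s n))) A"
    by eventually_elim (auto intro!: mono_onI divide_right_mono tail_antimono tail_nonneg
        simp: divide_right_mono)
  show "((\<lambda>n. tail (cdf M) (1 - x / s n) / tail (cdf M) (1 - 1 / s n)) \<longlongrightarrow> x powr \<alpha>) A"
    if "0 < x" for x
    using rv that unfolding tail_regularly_varying_at_1_def
    by (auto intro: filterlim_compose[OF _ s])
  show "isCont (\<lambda>x. x powr \<alpha>) x"
    using \<open>0 < x\<close> by (auto intro!: continuous_intros)
qed (use assms in auto)

text \<open>At \<open>x = 1\<close> the defining quotient must tend to \<open>1\<close>, which excludes the value \<open>0 / 0 = 0\<close>.\<close>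

lemma tail_regularly_varying_at_1_pos:
  assumes rv: "tail_regularly_varying_at_1 G \<alpha>" and "\<And>x. 0 \<le> tail G x"
  shows "eventually (\<lambda>u. 0 < tail G (1 - 1 / u)) at_top"
proof -
  have "((\<lambda>u. tail G (1 - 1 / u) / tail G (1 - 1 / u)) \<longlongrightarrow> 1) at_top"
    using rv[unfolded tail_regularly_varying_at_1_def, rule_format, of 1] by simp
  then have "eventually (\<lambda>u. tail G (1 - 1 / u) / tail G (1 - 1 / u) > 0) at_top"
    by (rule order_tendstoD) simp
  then show ?thesis
    by eventually_elim (use assms(2) in \<open>auto simp: less_le\<close>)
qed

section \<open>Integrals against a regularly varying law\<close>

lemma (in real_distribution) layer_cake:
  assumes [measurable]: "\<phi> \<in> borel_measurable borel"
    and range: "AE t in M. \<phi> t \<in> {0..1}"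
  shows "(\<integral>t. \<phi> t \<partial>M) = (LBINT y:{0<..<1}. measure M {t. y < \<phi> t})"
proof -
  interpret L: pair_sigma_finite M lborel
    by (intro pair_sigma_finite.intro sigma_finite_measure_axioms) (rule lborel.sigma_finite_measure_axioms)
  have [measurable]: "(\<lambda>y. measure M {t. y < \<phi> t}) \<in> borel_measurable borel"
  proof -
    have "antimono (\<lambda>y. measure M {t. y < \<phi> t})"
      by (auto intro!: antimonoI finite_measure_mono)
    then have "(\<lambda>y. - measure M {t. y < \<phi> t}) \<in> borel_measurable borel"
      by (intro borel_measurable_mono) (auto simp: monotone_def)
    then show ?thesis by (simp)
  qed
  have "ennreal (\<integral>t. \<phi> t \<partial>M) = (\<integral>\<^sup>+t. ennreal (\<phi> t) \<partial>M)"
    by (rule nn_integral_eq_integral[symmetric])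
       (use range in \<open>auto intro!: integrable_const_bound[where B = 1]\<close>)
  also have "\<dots> = (\<integral>\<^sup>+t. (\<integral>\<^sup>+y. indicator {(t, y). 0 < y \<and> y < 1 \<and> y < \<phi> t} (t, y) \<partial>lborel) \<partial>M)"
  proof (rule nn_integral_cong_AE, use range in eventually_elim)
    case (elim t)
    have "(\<integral>\<^sup>+y. indicator {(t, y). 0 < y \<and> y < 1 \<and> y < \<phi> t} (t, y) \<partial>lborel)
        = (\<integral>\<^sup>+y. indicator {0<..<\<phi> t} y \<partial>lborel)"
      using elim by (intro nn_integral_cong) (auto simp: indicator_def)
    also have "\<dots> = ennreal (\<phi> t)"
      using elim by simp
    finally show ?case by simp
  qed
  also have "\<dots> = (\<integral>\<^sup>+y. (\<integral>\<^sup>+t. indicator {(t, y). 0 < y \<and> y < 1 \<and> y < \<phi> t} (t, y) \<partial>M) \<partial>lborel)"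
    by (rule L.Fubini'[symmetric]) measurable
  also have "\<dots> = (\<integral>\<^sup>+y. ennreal (indicator {0<..<1} y *\<^sub>R measure M {t. y < \<phi> t}) \<partial>lborel)"
  proof (rule nn_integral_cong)
    fix y :: real
    have "(\<integral>\<^sup>+t. indicator {(t, y). 0 < y \<and> y < 1 \<and> y < \<phi> t} (t, y) \<partial>M)
        = (\<integral>\<^sup>+t. indicator {0<..<1} y * indicator {t. y < \<phi> t} t \<partial>M)"
      by (intro nn_integral_cong) (auto simp: indicator_def)
    also have "\<dots> = indicator {0<..<1} y * emeasure M {t. y < \<phi> t}"
      by (subst nn_integral_cmult) auto
    finally show "(\<integral>\<^sup>+t. indicator {(t, y). 0 < y \<and> y < 1 \<and> y < \<phi> t} (t, y) \<partial>M)
        = ennreal (indicator {0<..<1} y *\<^sub>R measure M {t. y < \<phi> t})"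
      by (auto simp: emeasure_eq_measure indicator_def)
  qed
  also have "\<dots> = ennreal (LBINT y:{0<..<1}. measure M {t. y < \<phi> t})"
    unfolding set_lebesgue_integral_def
  proof (rule nn_integral_eq_integral)
    show "integrable lborel (\<lambda>y. indicator {0<..<1} y *\<^sub>R measure M {t. y < \<phi> t})"
      by (rule Bochner_Integration.integrable_bound[where f = "indicator {0<..<1::real} :: real \<Rightarrow> real"])
         (auto simp: indicator_def)
  qed simp
  finally show ?thesis
    by (subst (asm) ennreal_inj)
       (use range in \<open>auto intro!: integral_nonneg_AE simp: set_lebesgue_integral_def\<close>)
qed

text \<open>By the layer cake formula the integral of \<open>\<phi> n\<close> is the integral over \<open>y\<close> in \<open>(0, 1)\<close> of the mass
  of \<open>{t. y < \<phi> n t}\<close>.  As \<open>\<phi> n\<close> is increasing, this set is a final segment of \<open>(0, 1)\<close>, and the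
  hypotheses \<open>low\<close> and \<open>up\<close> say that it starts near \<open>1 - q y / s n\<close>; so its normalised mass tends to
  \<open>q y powr \<alpha>\<close>.  Working with level sets keeps the integrating measure fixed (Lebesgue measure in
  \<open>y\<close>), so that ordinary dominated convergence applies, and it makes the degenerate indices \<open>\<alpha> = 0\<close> and
  (in the application to two regularly varying factors) \<open>\<gamma> = 0\<close> part of the general case.\<close>

lemma (in real_distribution) regular_variation_integral_limit:
  fixes \<phi> :: "nat \<Rightarrow> real \<Rightarrow> real" and s :: "nat \<Rightarrow> real" and q D :: "real \<Rightarrow> real"
  assumes rv: "tail_regularly_varying_at_1 (cdf M) \<alpha>"
    and supp: "AE t in M. t \<in> {0<..<1}"
    and s: "filterlim s at_top sequentially"
    and meas: "\<And>n. \<phi> n \<in> borel_measurable borel"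
    and mono: "\<forall>\<^sub>F n in sequentially. mono_on {0<..<1} (\<phi> n) \<and> \<phi> n ` {0<..<1} \<subseteq> {0..1}"
    and q: "\<And>y. y \<in> {0<..<1} \<Longrightarrow> 0 < q y"
    and q_meas: "q \<in> borel_measurable borel"
    and low: "\<And>x y. y \<in> {0<..<1} \<Longrightarrow> 0 < x \<Longrightarrow> x < q y \<Longrightarrow> \<forall>\<^sub>F n in sequentially. y < \<phi> n (1 - x / s n)"
    and up: "\<And>x y. y \<in> {0<..<1} \<Longrightarrow> q y < x \<Longrightarrow> \<forall>\<^sub>F n in sequentially. \<phi> n (1 - x / s n) \<le> y"
    and dom: "\<forall>\<^sub>F n in sequentially. \<forall>y\<in>{0<..<1}.
      measure M {t. y < \<phi> n t} / tail (cdf M) (1 - 1 / s n) \<le> D y"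
    and D: "set_integrable lborel {0<..<1} D"
  shows "(\<lambda>n. (\<integral>t. \<phi> n t \<partial>M) / tail (cdf M) (1 - 1 / s n)) \<longlonglongrightarrow> (LBINT y:{0<..<1}. q y powr \<alpha>)"
proof -
  define p where "p n = tail (cdf M) (1 - 1 / s n)" for n
  have p_nonneg: "0 \<le> p n" for n by (simp add: p_def tail_nonneg)
  have in_unit: "\<forall>\<^sub>F n in sequentially. 1 - x / s n \<in> {0<..<1}" if "0 < x" for x
  proof -
    have "\<forall>\<^sub>F n in sequentially. s n > x"
      using s by (simp add: filterlim_at_top_dense)
    then show ?thesis
      by eventually_elim (use that in auto)
  qed
  have tail_lim: "(\<lambda>n. tail (cdf M) (1 - x / s n) / p n) \<longlonglongrightarrow> x powr \<alpha>" if "0 < x" for x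
    unfolding p_def using tail_regularly_varying_at_1_moving[OF rv s tendsto_const that] .
  have pointwise: "(\<lambda>n. measure M {t. y < \<phi> n t} / p n) \<longlonglongrightarrow> q y powr \<alpha>" if y: "y \<in> {0<..<1}" for y
  proof (rule order_tendstoI)
    have cont: "isCont (\<lambda>x. x powr \<alpha>) (q y)"
      using q[OF y] by (auto intro!: continuous_intros)
    fix c assume "c < q y powr \<alpha>"
    then have "eventually (\<lambda>x. x powr \<alpha> > c) (at (q y))"
      using cont unfolding isCont_def by (rule order_tendstoD(1)[rotated])
    then have "eventually (\<lambda>x. x powr \<alpha> > c) (at_left (q y))"
      by (rule filter_leD[OF at_le, rotated]) simp
    then obtain b where b: "b < q y" "\<And>x. b < x \<Longrightarrow> x < q y \<Longrightarrow> x powr \<alpha> > c"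
      using eventually_at_left[of "q y - 1" "q y"] by auto
    obtain x where x: "max 0 b < x" "x < q y"
      using b(1) q[OF y] dense[of "max 0 b" "q y"] by auto
    have x0: "0 < x" using x by simp
    have "\<forall>\<^sub>F n in sequentially. tail (cdf M) (1 - x / s n) / p n > c"
      using order_tendstoD(1)[OF tail_lim b(2)] x by auto
    then show "\<forall>\<^sub>F n in sequentially. c < measure M {t. y < \<phi> n t} / p n"
      using low[OF y x0 x(2)] in_unit[OF x0] mono
    proof eventually_elim
      case (elim n)
      have "tail (cdf M) (1 - x / s n) \<le> measure M {t. y < \<phi> n t}"
        unfolding tail_cdf
      proof (rule finite_measure_mono_AE)
        show "AE t in M. t \<in> {1 - x / s n<..} \<longrightarrow> t \<in> {t. y < \<phi> n t}"
          using supp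
        proof eventually_elim
          case (elim t)
          show ?case
          proof
            assume "t \<in> {1 - x / s n<..}"
            then have "\<phi> n (1 - x / s n) \<le> \<phi> n t"
              using elim \<open>1 - x / s n \<in> _\<close> \<open>mono_on _ (\<phi> n) \<and> _\<close> by (auto intro: mono_onD)
            then show "t \<in> {t. y < \<phi> n t}"
              using \<open>y < \<phi> n (1 - x / s n)\<close> by auto
          qed
        qed
      qed (use meas in measurable)
      then have "tail (cdf M) (1 - x / s n) / p n \<le> measure M {t. y < \<phi> n t} / p n"
        using p_nonneg by (rule divide_right_mono)
      then show ?case using elim by linarith
    qed
  next
    have cont: "isCont (\<lambda>x. x powr \<alpha>) (q y)"
      using q[OF y] by (auto intro!: continuous_intros)
    fix c assume "c > q y powr \<alpha>"
    then have "eventually (\<lambda>x. x powr \<alpha> < c) (at (q y))"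
      using cont unfolding isCont_def by (rule order_tendstoD(2)[rotated])
    then have "eventually (\<lambda>x. x powr \<alpha> < c) (at_right (q y))"
      by (rule filter_leD[OF at_le, rotated]) simp
    then obtain b where b: "b > q y" "\<And>x. q y < x \<Longrightarrow> x < b \<Longrightarrow> x powr \<alpha> < c"
      using eventually_at_right[of "q y" "q y + 1"] by auto
    obtain x where x: "x < b" "q y < x"
      using b(1) dense[of "q y" b] by auto
    have x0: "0 < x" using q[OF y] x by simp
    have "\<forall>\<^sub>F n in sequentially. tail (cdf M) (1 - x / s n) / p n < c"
      using order_tendstoD(2)[OF tail_lim[OF x0] b(2)] x by auto
    then show "\<forall>\<^sub>F n in sequentially. measure M {t. y < \<phi> n t} / p n < c"
      using up[OF y x(2)] in_unit[OF x0] mono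
    proof eventually_elim
      case (elim n)
      have "measure M {t. y < \<phi> n t} \<le> tail (cdf M) (1 - x / s n)"
        unfolding tail_cdf
      proof (rule finite_measure_mono_AE)
        show "AE t in M. t \<in> {t. y < \<phi> n t} \<longrightarrow> t \<in> {1 - x / s n<..}"
          using supp
        proof eventually_elim
          case (elim t)
          have "\<phi> n t \<le> \<phi> n (1 - x / s n)" if "t \<le> 1 - x / s n"
            using that elim \<open>1 - x / s n \<in> _\<close> \<open>mono_on _ (\<phi> n) \<and> _\<close> by (auto intro: mono_onD)
          then show ?case
            using \<open>\<phi> n (1 - x / s n) \<le> y\<close> by force
        qed
      qed (use meas in measurable)
      then have "measure M {t. y < \<phi> n t} / p n \<le> tail (cdf M) (1 - x / s n) / p n"
        using p_nonneg by (rule divide_right_mono)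
      then show ?case using elim by linarith
    qed
  qed
  obtain N where N: "\<And>n y. N \<le> n \<Longrightarrow> y \<in> {0<..<1} \<Longrightarrow> measure M {t. y < \<phi> n t} / p n \<le> D y"
    "\<And>n. N \<le> n \<Longrightarrow> mono_on {0<..<1} (\<phi> n) \<and> \<phi> n ` {0<..<1} \<subseteq> {0..1}"
    using eventually_conj[OF dom mono] unfolding eventually_sequentially p_def by blast
  define I where "I n y = indicator {0<..<1} y *\<^sub>R (measure M {t. y < \<phi> n t} / p n)" for n and y :: real
  have I_meas: "I n \<in> borel_measurable borel" for n
  proof -
    have "antimono (\<lambda>y. measure M {t. y < \<phi> n t})"
      using meas[of n] by (auto intro!: antimonoI finite_measure_mono)
    then have "(\<lambda>y. - measure M {t. y < \<phi> n t}) \<in> borel_measurable borel"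
      by (intro borel_measurable_mono) (auto simp: monotone_def)
    then have [measurable]: "(\<lambda>y. measure M {t. y < \<phi> n t}) \<in> borel_measurable borel"
      by simp
    show ?thesis unfolding I_def by measurable
  qed
  have eq: "(\<integral>t. \<phi> n t \<partial>M) / p n = (\<integral>y. I n y \<partial>lborel)" if "N \<le> n" for n
  proof -
    have "AE t in M. \<phi> n t \<in> {0..1}"
      using supp by eventually_elim (use N(2)[OF that] in blast)
    then have "(\<integral>t. \<phi> n t \<partial>M) = (LBINT y:{0<..<1}. measure M {t. y < \<phi> n t})"
      by (intro layer_cake meas)
    also have "\<dots> / p n = (\<integral>y. I n y \<partial>lborel)"
      unfolding set_lebesgue_integral_def I_def
      by (simp only: integral_divide_zero[symmetric]) (simp add: divide_simps)
    finally show ?thesis .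
  qed
  have "(\<lambda>n. \<integral>y. I (n + N) y \<partial>lborel) \<longlonglongrightarrow> (\<integral>y. indicator {0<..<1} y *\<^sub>R (q y powr \<alpha>) \<partial>lborel)"
  proof (rule integral_dominated_convergence[where w = "\<lambda>y. indicator {0<..<1} y *\<^sub>R D y"])
    show "integrable lborel (\<lambda>y. indicator {0<..<1} y *\<^sub>R D y)"
      using D by (simp add: set_integrable_def)
    show "AE y in lborel. (\<lambda>n. I (n + N) y) \<longlonglongrightarrow> indicator {0<..<1} y *\<^sub>R (q y powr \<alpha>)"
    proof (intro AE_I2)
      fix y :: real
      show "(\<lambda>n. I (n + N) y) \<longlonglongrightarrow> indicator {0<..<1} y *\<^sub>R (q y powr \<alpha>)"
        unfolding I_def using LIMSEQ_ignore_initial_segment[OF pointwise, of y N]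
        by (auto simp: indicator_def)
    qed
    show "AE y in lborel. norm (I (n + N) y) \<le> indicator {0<..<1} y *\<^sub>R D y" for n
      using N(1)[of "n + N"] p_nonneg by (auto simp: I_def indicator_def)
    show "(\<lambda>y. indicator {0<..<1} y *\<^sub>R (q y powr \<alpha>)) \<in> borel_measurable lborel"
      using q_meas by measurable
    show "I (n + N) \<in> borel_measurable lborel" for n
      using I_meas by simp
  qed
  then have "(\<lambda>n. (\<integral>t. \<phi> (n + N) t \<partial>M) / p (n + N)) \<longlonglongrightarrow> (LBINT y:{0<..<1}. q y powr \<alpha>)"
    by (simp add: eq set_lebesgue_integral_def)
  then show ?thesis
    unfolding p_def by (rule LIMSEQ_offset)
qed

text \<open>A Potter bound with the wasteful exponent \<open>\<alpha> + 1\<close>.  Far out, doubling \<open>x\<close> multiplies the tail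
  by at most \<open>2 powr (\<alpha> + 1)\<close>, because the limiting factor is \<open>2 powr \<alpha>\<close>; iterating this covers all
  powers of two, and monotonicity covers the rest.\<close>

lemma (in real_distribution) tail_regularly_varying_at_1_power_bound:
  assumes rv: "tail_regularly_varying_at_1 (cdf M) \<alpha>" and \<alpha>: "0 \<le> \<alpha>"
  obtains C s0 where "0 < C" "0 < s0"
    "\<And>s x. s0 \<le> s \<Longrightarrow> 1 \<le> x \<Longrightarrow>
      tail (cdf M) (1 - x / s) \<le> C * x powr (\<alpha> + 1) * tail (cdf M) (1 - 1 / s)"
proof -
  let ?g = "tail (cdf M)"
  have "((\<lambda>s. ?g (1 - 2 / s) / ?g (1 - 1 / s)) \<longlongrightarrow> 2 powr \<alpha>) at_top"
    using rv by (simp add: tail_regularly_varying_at_1_def)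
  then have "\<forall>\<^sub>F s in at_top. ?g (1 - 2 / s) / ?g (1 - 1 / s) < 2 powr (\<alpha> + 1)"
    by (rule order_tendstoD) simp
  then have "\<forall>\<^sub>F s in at_top. s > 0 \<and> ?g (1 - 1 / s) > 0 \<and> ?g (1 - 2 / s) \<le> 2 powr (\<alpha> + 1) * ?g (1 - 1 / s)"
    using tail_regularly_varying_at_1_pos[OF rv tail_nonneg] eventually_gt_at_top[of 0]
    by eventually_elim (simp add: pos_divide_less_eq less_imp_le)
  then obtain s0 where s0: "\<And>s. s \<ge> s0 \<Longrightarrow> s > 0 \<and> ?g (1 - 1 / s) > 0 \<and> ?g (1 - 2 / s) \<le> 2 powr (\<alpha> + 1) * ?g (1 - 1 / s)"
    unfolding eventually_at_top_linorder by blast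
  \<comment> \<open>Halving \<open>s\<close> stops once \<open>s < 2 * s0\<close>.  There the left-hand side is at most \<open>1\<close>, which this
    \<open>C\<close> absorbs.\<close>
  define C where "C = 1 / ?g (1 - 1 / (2 * s0))"
  have s0_pos: "s0 > 0" using s0[of s0] by simp
  have g0: "?g (1 - 1 / (2 * s0)) > 0" using s0[of "2 * s0"] s0_pos by simp
  have C: "C > 0" using g0 by (simp add: C_def)
  have dyadic: "?g (1 - 2 ^ k / s) \<le> C * (2 ^ k) powr (\<alpha> + 1) * ?g (1 - 1 / s)" if "s0 \<le> s" for k s
    using that
  proof (induction k arbitrary: s)
    case 0
    have "?g (1 - 1 / (2 * s0)) \<le> 1" by (rule tail_le_1)
    then have "1 \<le> C" using g0 by (simp add: C_def)
    then show ?case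
      using mult_right_mono[of 1 C "?g (1 - 1 / s)"] tail_nonneg by simp
  next
    case (Suc k)
    have pw: "(2 ^ Suc k) powr (\<alpha> + 1) = (2 ^ k) powr (\<alpha> + 1) * 2 powr (\<alpha> + 1)"
      by (simp add: powr_mult)
    show ?case
    proof (cases "2 * s0 \<le> s")
      case True
      have "?g (1 - 2 ^ Suc k / s) = ?g (1 - 2 ^ k / (s / 2))"
        by (simp add: mult.commute)
      also have "\<dots> \<le> C * (2 ^ k) powr (\<alpha> + 1) * ?g (1 - 1 / (s / 2))"
        using True by (intro Suc.IH) simp
      also have "?g (1 - 1 / (s / 2)) = ?g (1 - 2 / s)" by simp
      also have "C * (2 ^ k) powr (\<alpha> + 1) * ?g (1 - 2 / s)
          \<le> C * (2 ^ k) powr (\<alpha> + 1) * (2 powr (\<alpha> + 1) * ?g (1 - 1 / s))"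
        using s0[OF Suc.prems] C by (intro mult_left_mono) auto
      finally show ?thesis by (simp only: pw mult_ac)
    next
      case False
      have "1 - 1 / s \<le> 1 - 1 / (2 * s0)"
        using False Suc.prems s0_pos by (auto intro!: divide_left_mono)
      then have "1 \<le> C * ?g (1 - 1 / s)"
        using tail_antimono g0 by (simp add: C_def)
      moreover have "1 \<le> (2 ^ Suc k :: real) powr (\<alpha> + 1)"
        using \<alpha> by (intro ge_one_powr_ge_zero) (auto simp: one_le_power simp del: power_Suc)
      ultimately have "1 * 1 \<le> (C * ?g (1 - 1 / s)) * (2 ^ Suc k) powr (\<alpha> + 1)"
        using C tail_nonneg by (intro mult_mono) auto
      then show ?thesis
        using tail_le_1[of "1 - 2 ^ Suc k / s"] by (simp add: mult_ac)
    qed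
  qed
  show thesis
  proof (rule that)
    show "0 < C * 2 powr (\<alpha> + 1)" "0 < s0"
      using C s0_pos by auto
    fix s x :: real
    assume s: "s0 \<le> s" and x: "1 \<le> x"
    define k where "k = nat \<lceil>log 2 x\<rceil>"
    have k: "log 2 x \<le> k" "k < log 2 x + 1"
      unfolding k_def using x by (auto simp: of_nat_nat) linarith+
    have "x = 2 powr log 2 x" using x by simp
    also have "\<dots> \<le> 2 powr k" using k by (intro powr_mono) auto
    finally have k1: "x \<le> 2 ^ k" by (simp add: powr_realpow)
    have "2 powr k \<le> 2 powr (log 2 x + 1)" using k by (intro powr_mono) auto
    also have "\<dots> = 2 * x" using x by (simp add: powr_add)
    finally have k2: "2 ^ k \<le> 2 * x" by (simp add: powr_realpow)
    have "?g (1 - x / s) \<le> ?g (1 - 2 ^ k / s)"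
      using s s0_pos k1 by (intro tail_antimono) (simp add: divide_right_mono)
    also have "\<dots> \<le> C * (2 ^ k) powr (\<alpha> + 1) * ?g (1 - 1 / s)"
      by (rule dyadic[OF s])
    also have "\<dots> \<le> C * (2 * x) powr (\<alpha> + 1) * ?g (1 - 1 / s)"
      using C k2 \<alpha> tail_nonneg by (intro mult_right_mono mult_left_mono powr_mono2) auto
    also have "(2 * x) powr (\<alpha> + 1) = 2 powr (\<alpha> + 1) * x powr (\<alpha> + 1)"
      using x by (simp add: powr_mult)
    finally show "?g (1 - x / s) \<le> C * 2 powr (\<alpha> + 1) * x powr (\<alpha> + 1) * ?g (1 - 1 / s)"
      by (simp add: mult_ac)
  qed
qed

section \<open>The Gumbel domain of attraction\<close>

lemma (in real_distribution) upper_endpoint_neq_MInf: "upper_endpoint (cdf M) \<noteq> - \<infinity>"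
proof -
  have "eventually (\<lambda>x. cdf M x < 1) at_bot"
    using cdf_lim_at_bot by (rule order_tendstoD) simp
  then obtain x where "cdf M x < 1"
    by (meson eventually_happens trivial_limit_at_bot_linorder)
  then have "ereal x \<le> upper_endpoint (cdf M)"
    unfolding upper_endpoint_def by (intro SUP_upper) simp
  then show ?thesis by auto
qed

lemma (in real_distribution) tail_pos:
  assumes "ereal x < upper_endpoint (cdf M)"
  shows "0 < tail (cdf M) x"
proof -
  obtain y where "cdf M y < 1" "x < y"
    using assms by (auto simp: upper_endpoint_def less_SUP_iff)
  with cdf_nondecreasing[of x y] show ?thesis by (simp add: tail_def)
qed

locale gumbel_distribution = real_distribution +
  fixes w :: "real \<Rightarrow> real"
  assumes gumbel: "MDA_Gumbel (cdf M) w"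
begin

abbreviation r :: ereal where "r \<equiv> upper_endpoint (cdf M)"

lemma ev_less_endpoint: "eventually (\<lambda>u. ereal u < r) (up_to r)"
  unfolding eventually_up_to[OF upper_endpoint_neq_MInf]
  using upper_endpoint_neq_MInf ereal_dense2[of "- \<infinity>" r] by auto

lemma ev_greater:
  assumes "ereal a < r"
  shows "eventually (\<lambda>u. a < u) (up_to r)"
  unfolding eventually_up_to[OF upper_endpoint_neq_MInf] using assms by auto

lemma w_pos: "ereal u < r \<Longrightarrow> 0 < w u"
  using gumbel by (simp add: MDA_Gumbel_def)

lemma ev_w_pos: "eventually (\<lambda>u. 0 < w u) (up_to r)"
  using ev_less_endpoint by eventually_elim (rule w_pos)

lemma ev_tail_pos: "eventually (\<lambda>u. 0 < tail (cdf M) u) (up_to r)"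
  using ev_less_endpoint by eventually_elim (rule tail_pos)

lemma u_w_at_top: "filterlim (\<lambda>u. u * w u) at_top (up_to r)"
  using gumbel by (simp add: MDA_Gumbel_def)

lemma ev_pos: "eventually (\<lambda>u. 0 < u) (up_to r)"
proof -
  have "eventually (\<lambda>u. 0 < u * w u) (up_to r)"
    using u_w_at_top by (simp add: filterlim_at_top_dense)
  then show ?thesis
    using ev_w_pos by eventually_elim (simp add: zero_less_mult_iff)
qed

lemma tail_ratio: "((\<lambda>u. tail (cdf M) (u + x / w u) / tail (cdf M) u) \<longlongrightarrow> exp (- x)) (up_to r)"
  using gumbel by (simp add: MDA_Gumbel_def)

text \<open>A shift by a bounded number of units \<open>1 / w u\<close> does not leave the neighbourhood of the endpoint:
  \<open>u * w u\<close> tending to infinity prevents this below and, for a finite endpoint,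
  \<open>w u * (b - u)\<close> tending to infinity prevents it above.\<close>

lemma filterlim_shift: "filterlim (\<lambda>u. u + x / w u) (up_to r) (up_to r)"
proof (cases "r = \<infinity>")
  case True
  have "eventually (\<lambda>u. a < u + x / w u) (up_to r)" for a
  proof -
    have "eventually (\<lambda>u. 2 * \<bar>x\<bar> < u * w u) (up_to r)"
      using u_w_at_top by (simp add: filterlim_at_top_dense)
    then show ?thesis
      using ev_w_pos ev_greater[of "2 * a", simplified True, simplified] unfolding True
    proof eventually_elim
      case (elim u)
      have "- (u / 2) < x / w u"
        using elim by (simp add: field_simps)
      with elim show ?case by simp
    qed
  qed
  then show ?thesis
    by (intro filterlim_up_toI) (auto simp: True)
next
  case False
  then obtain b where b: "r = ereal b"
    using upper_endpoint_neq_MInf by (cases r) auto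
  have *: "filterlim (\<lambda>u. w u * (b - u)) at_top (up_to r)"
    using gumbel unfolding MDA_Gumbel_def b by simp
  then have **: "eventually (\<lambda>u. \<bar>x\<bar> < w u * (b - u)) (up_to r)"
    by (simp add: filterlim_at_top_dense)
  have "eventually (\<lambda>u. a < u + x / w u) (up_to r)" if "a < b" for a
  proof -
    have "ereal ((a + b) / 2) < r" using that by (simp add: b)
    from ** ev_w_pos ev_greater[OF this] show ?thesis
    proof eventually_elim
      case (elim u)
      have "- (b - u) < x / w u"
        using elim by (simp add: field_simps)
      moreover have "(a + b) / 2 < u"
        using elim that by (simp add: b)
      ultimately show ?case by simp
    qed
  qed
  moreover have "eventually (\<lambda>u. u + x / w u < b) (up_to r)"
    using ** ev_w_pos
  proof eventually_elim
    case (elim u)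
    have "x / w u < b - u"
      using elim by (simp add: field_simps)
    then show ?case by simp
  qed
  ultimately show ?thesis
    by (intro filterlim_up_toI upper_endpoint_neq_MInf) (auto simp: b)
qed

lemma tail_ratio2:
  "((\<lambda>u. tail (cdf M) (u + y / w u) / tail (cdf M) (u + x / w u)) \<longlongrightarrow> exp (x - y)) (up_to r)"
proof -
  have "((\<lambda>u. (tail (cdf M) (u + y / w u) / tail (cdf M) u) / (tail (cdf M) (u + x / w u) / tail (cdf M) u))
      \<longlongrightarrow> exp (- y) / exp (- x)) (up_to r)"
    by (intro tendsto_divide tail_ratio) auto
  moreover have "exp (- y) / exp (- x) = exp (x - y)"
    by (simp add: exp_diff[symmetric])
  ultimately show ?thesis
    by (rule_tac Lim_transform_eventually) (use ev_tail_pos in \<open>auto elim!: eventually_mono\<close>)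
qed

text \<open>The scale \<open>1 / w\<close> is self-neglecting.  A jump of \<open>w\<close> by a factor bounded away from \<open>1\<close>
  between \<open>u\<close> and \<open>v = u + x / w u\<close> would make the tail at \<open>v + 1 / w v\<close>, which is about
  \<open>exp (- 1)\<close> times the tail at \<open>v\<close>, disagree with its value computed from \<open>u\<close>.\<close>

lemma w_self_neglecting: "((\<lambda>u. w (u + x / w u) / w u) \<longlongrightarrow> 1) (up_to r)"
proof -
  define v where "v u = u + x / w u" for u
  have v: "filterlim v (up_to r) (up_to r)"
    unfolding v_def by (rule filterlim_shift)
  have step: "((\<lambda>u. tail (cdf M) (v u + 1 / w (v u)) / tail (cdf M) (v u)) \<longlongrightarrow> exp (- 1)) (up_to r)"
    using filterlim_compose[OF tail_ratio v] .
  have from_u: "((\<lambda>u. tail (cdf M) (u + (x + c) / w u) / tail (cdf M) (v u)) \<longlongrightarrow> exp (- c)) (up_to r)" for c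
    unfolding v_def using tail_ratio2[of "x + c" x] by simp
  have ev_v: "eventually (\<lambda>u. 0 < w (v u)) (up_to r)" "eventually (\<lambda>u. 0 < tail (cdf M) (v u)) (up_to r)"
    using ev_w_pos ev_tail_pos v by (auto simp: filterlim_iff)
  have "((\<lambda>u. w (v u) / w u) \<longlongrightarrow> 1) (up_to r)"
  proof (rule order_tendstoI)
    fix c :: real assume c: "c < 1"
    show "\<forall>\<^sub>F u in up_to r. c < w (v u) / w u"
    proof (cases "0 < c")
      case True
      then have "- (1 / c) < - 1" using c by (simp add: field_simps)
      then obtain m where m: "- (1 / c) < m" "m < - 1" using dense by blast
      have "\<forall>\<^sub>F u in up_to r. exp m < tail (cdf M) (v u + 1 / w (v u)) / tail (cdf M) (v u)"
        using order_tendstoD(1)[OF step] m by simp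
      moreover have "\<forall>\<^sub>F u in up_to r. tail (cdf M) (u + (x + 1 / c) / w u) / tail (cdf M) (v u) < exp m"
        using order_tendstoD(2)[OF from_u] m by simp
      ultimately show ?thesis
        using ev_v ev_w_pos
      proof eventually_elim
        case (elim u)
        show ?case
        proof (rule ccontr)
          assume "\<not> c < w (v u) / w u"
          then have "w (v u) \<le> c * w u" using elim by (simp add: field_simps)
          then have "1 / c / w u \<le> 1 / w (v u)" using elim True by (simp add: field_simps)
          then have "u + (x + 1 / c) / w u \<le> v u + 1 / w (v u)"
            by (simp add: v_def add_divide_distrib)
          then have "tail (cdf M) (v u + 1 / w (v u)) \<le> tail (cdf M) (u + (x + 1 / c) / w u)"
            by (rule tail_antimono)
          then have "tail (cdf M) (v u + 1 / w (v u)) / tail (cdf M) (v u)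
              \<le> tail (cdf M) (u + (x + 1 / c) / w u) / tail (cdf M) (v u)"
            using elim by (intro divide_right_mono) auto
          with elim show False by linarith
        qed
      qed
    next
      case False
      show ?thesis
        using ev_v(1) ev_w_pos
      proof eventually_elim
        case (elim u)
        then have "0 < w (v u) / w u" by simp
        with False show ?case by linarith
      qed
    qed
  next
    fix c :: real assume c: "1 < c"
    then have "- 1 < - (1 / c)" by (simp add: field_simps)
    then obtain m where m: "- 1 < m" "m < - (1 / c)" using dense by blast
    have "\<forall>\<^sub>F u in up_to r. exp m > tail (cdf M) (v u + 1 / w (v u)) / tail (cdf M) (v u)"
      using order_tendstoD(2)[OF step] m by simp
    moreover have "\<forall>\<^sub>F u in up_to r. tail (cdf M) (u + (x + 1 / c) / w u) / tail (cdf M) (v u) > exp m"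
      using order_tendstoD(1)[OF from_u] m by simp
    ultimately show "\<forall>\<^sub>F u in up_to r. w (v u) / w u < c"
      using ev_v ev_w_pos
    proof eventually_elim
      case (elim u)
      show ?case
      proof (rule ccontr)
        assume "\<not> w (v u) / w u < c"
        then have "c * w u \<le> w (v u)" using elim by (simp add: field_simps)
        then have "1 / w (v u) \<le> 1 / c / w u" using elim c by (simp add: field_simps)
        then have "v u + 1 / w (v u) \<le> u + (x + 1 / c) / w u"
          by (simp add: v_def add_divide_distrib)
        then have "tail (cdf M) (u + (x + 1 / c) / w u) \<le> tail (cdf M) (v u + 1 / w (v u))"
          by (rule tail_antimono)
        then have "tail (cdf M) (u + (x + 1 / c) / w u) / tail (cdf M) (v u)
            \<le> tail (cdf M) (v u + 1 / w (v u)) / tail (cdf M) (v u)"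
          using elim by (intro divide_right_mono) auto
        with elim show False by linarith
      qed
    qed
  qed
  then show ?thesis by (simp add: v_def)
qed

text \<open>On the scale \<open>1 / w u\<close> the tail decays faster than any power.  Since \<open>w\<close> is self-neglecting, each
  halving step \<open>u \<mapsto> u + 1 / w u\<close> is at most \<open>\<theta>\<close> times as long as the preceding one, for any chosen \<open>\<theta> > 1\<close>.
  To go the distance \<open>x / w u\<close> then takes at least about \<open>log \<theta> x\<close> steps, a gain of \<open>x powr (- p)\<close> with
  \<open>\<theta> powr p = 2\<close>.\<close>

lemma tail_power_bound:
  assumes "0 < p"
  obtains C where "1 \<le> C"
    "eventually (\<lambda>u. \<forall>x>0. tail (cdf M) (u + x / w u) \<le> C * x powr (- p) * tail (cdf M) u) (up_to r)"
proof -
  let ?f = "tail (cdf M)"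
  define \<theta> where "\<theta> = 2 powr (1 / p)"
  have \<theta>: "1 < \<theta>" "\<theta> powr p = 2"
    using assms by (auto simp: \<theta>_def powr_powr intro!: gr_one_powr)
  have "((\<lambda>u. w (u + 1 / w u) / w u) \<longlongrightarrow> 1) (up_to r)"
    by (rule w_self_neglecting)
  then have 1: "eventually (\<lambda>u. 1 / \<theta> < w (u + 1 / w u) / w u) (up_to r)"
    by (rule order_tendstoD(1)) (use \<theta>(1) in simp)
  have "exp (- 1) < (1 / 2 :: real)"
    using exp_lower_Taylor_quadratic[of 1] by (simp add: exp_minus field_simps)
  then have 2: "eventually (\<lambda>u. ?f (u + 1 / w u) / ?f u < 1 / 2) (up_to r)"
    by (rule order_tendstoD(2)[OF tail_ratio])
  have 3: "eventually (\<lambda>u. ereal (u + 1 / w u) < r) (up_to r)"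
    using ev_less_endpoint filterlim_shift[of 1] by (auto simp: filterlim_iff)
  have "eventually (\<lambda>u. w u / \<theta> \<le> w (u + 1 / w u) \<and> ?f (u + 1 / w u) \<le> ?f u / 2 \<and>
      ereal (u + 1 / w u) < r) (up_to r)"
    using 1 2 3 ev_w_pos ev_tail_pos by eventually_elim (simp add: field_simps)
  then obtain a where a: "ereal a < r"
    "\<And>u. a < u \<Longrightarrow> ereal u < r \<Longrightarrow> w u / \<theta> \<le> w (u + 1 / w u)"
    "\<And>u. a < u \<Longrightarrow> ereal u < r \<Longrightarrow> ?f (u + 1 / w u) \<le> ?f u / 2"
    "\<And>u. a < u \<Longrightarrow> ereal u < r \<Longrightarrow> ereal (u + 1 / w u) < r"
    unfolding eventually_up_to[OF upper_endpoint_neq_MInf] by blast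
  \<comment> \<open>\<open>k\<close> steps of length \<open>1 / w\<close> halve the tail \<open>k\<close> times; each step is at most
    \<open>\<theta>\<close> times as long as the one before, whence the geometric sum.\<close>
  have geometric: "?f (u + ((\<theta> ^ k - 1) / (\<theta> - 1)) / w u) \<le> ?f u / 2 ^ k"
    if "a < u" "ereal u < r" for u k
    using that
  proof (induction k arbitrary: u)
    case (Suc k)
    define v where "v = u + 1 / w u"
    have wu: "0 < w u" using Suc.prems w_pos by simp
    have "0 < 1 / w u" using wu by simp
    then have v: "a < v" "ereal v < r"
      using Suc.prems(1) a(4)[OF Suc.prems] unfolding v_def by linarith+
    have wv: "0 < w v" using v w_pos by simp
    have nonneg: "0 \<le> (\<theta> ^ k - 1) / (\<theta> - 1)"
      using \<theta>(1) by (simp add: one_le_power)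
    have "1 / w v \<le> \<theta> / w u"
      using a(2)[OF Suc.prems] wu wv \<theta>(1) by (simp add: field_simps v_def)
    then have "((\<theta> ^ k - 1) / (\<theta> - 1)) * (1 / w v) \<le> ((\<theta> ^ k - 1) / (\<theta> - 1)) * (\<theta> / w u)"
      using nonneg by (rule mult_left_mono)
    moreover have "(\<theta> ^ Suc k - 1) / (\<theta> - 1) = 1 + ((\<theta> ^ k - 1) / (\<theta> - 1)) * \<theta>"
      using \<theta>(1) by (simp add: field_simps)
    ultimately have "v + ((\<theta> ^ k - 1) / (\<theta> - 1)) / w v \<le> u + ((\<theta> ^ Suc k - 1) / (\<theta> - 1)) / w u"
      by (simp add: v_def add_divide_distrib)
    then have "?f (u + ((\<theta> ^ Suc k - 1) / (\<theta> - 1)) / w u) \<le> ?f (v + ((\<theta> ^ k - 1) / (\<theta> - 1)) / w v)"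
      by (rule tail_antimono)
    also have "\<dots> \<le> ?f v / 2 ^ k"
      using v by (rule Suc.IH)
    also have "\<dots> \<le> (?f u / 2) / 2 ^ k"
      using a(3)[OF Suc.prems] by (intro divide_right_mono) (auto simp: v_def)
    finally show ?case by (simp add: field_simps)
  qed simp
  define C where "C = max 1 (2 * (1 / (\<theta> - 1)) powr p)"
  have "?f (u + x / w u) \<le> C * x powr (- p) * ?f u" if u: "a < u" "ereal u < r" and x: "0 < x" for u x
  proof (cases "x * (\<theta> - 1) < 1")
    case True
    have "1 = ((x * (\<theta> - 1)) * (1 / (\<theta> - 1)) * (1 / x)) powr p"
      using x \<theta>(1) by simp
    also have "\<dots> = (x * (\<theta> - 1)) powr p * ((1 / (\<theta> - 1)) powr p * (1 / x) powr p)"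
      by (simp only: powr_mult mult.assoc)
    also have "(1 / x) powr p = x powr (- p)"
      using x by (simp add: powr_divide powr_minus_divide)
    also have "(x * (\<theta> - 1)) powr p * ((1 / (\<theta> - 1)) powr p * x powr (- p))
        \<le> 1 * ((1 / (\<theta> - 1)) powr p * x powr (- p))"
      using True x \<theta>(1) assms by (intro mult_right_mono) (auto intro!: powr_le1)
    also have "\<dots> \<le> C * x powr (- p)"
      unfolding mult_1 using powr_ge_zero[of "1 / (\<theta> - 1)" p]
      by (intro mult_right_mono) (auto simp: C_def)
    finally have "?f u \<le> C * x powr (- p) * ?f u"
      using mult_right_mono[of 1 _ "?f u"] tail_nonneg by simp
    moreover have "?f (u + x / w u) \<le> ?f u"
      using w_pos[OF u(2)] x by (intro tail_antimono) simp
    ultimately show ?thesis by linarith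
  next
    case False
    define z where "z = x * (\<theta> - 1)"
    have z: "1 \<le> z" using False by (simp add: z_def)
    define k where "k = nat \<lfloor>log \<theta> z\<rfloor>"
    have "real k = real_of_int \<lfloor>log \<theta> z\<rfloor>"
      unfolding k_def using z \<theta>(1) by (simp add: of_nat_nat zero_le_log_cancel_iff)
    then have k: "k \<le> log \<theta> z" "log \<theta> z < k + 1"
      by linarith+
    have "\<theta> ^ k = \<theta> powr k" using \<theta>(1) by (simp add: powr_realpow)
    also have "\<dots> \<le> \<theta> powr (log \<theta> z)" using k \<theta>(1) by (intro powr_mono) auto
    also have "\<dots> = z" using z \<theta>(1) by simp
    finally have "(\<theta> ^ k - 1) / (\<theta> - 1) \<le> x"
      using \<theta>(1) by (simp add: z_def field_simps)
    then have "?f (u + x / w u) \<le> ?f (u + ((\<theta> ^ k - 1) / (\<theta> - 1)) / w u)"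
      using w_pos[OF u(2)] by (intro tail_antimono add_left_mono divide_right_mono) auto
    also have "\<dots> \<le> ?f u / 2 ^ k" by (rule geometric[OF u])
    finally have 1: "?f (u + x / w u) \<le> ?f u / 2 ^ k" .
    have "z powr p = (\<theta> powr log \<theta> z) powr p" using z \<theta>(1) by simp
    also have "\<dots> = 2 powr log \<theta> z" by (simp add: powr_powr mult.commute[of _ p] \<theta>(2)[symmetric])
    also have "\<dots> \<le> 2 powr (k + 1)" using k by (intro powr_mono) auto
    also have "\<dots> = 2 * 2 ^ k" by (simp add: powr_add powr_realpow)
    finally have "z powr p \<le> 2 * 2 ^ k" .
    then have "1 / 2 ^ k \<le> 2 * z powr (- p)"
      using z by (simp add: powr_minus field_simps)
    also have "z powr (- p) = x powr (- p) * (\<theta> - 1) powr (- p)"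
      unfolding z_def using x \<theta>(1) by (subst powr_mult) auto
    also have "(\<theta> - 1) powr (- p) = (1 / (\<theta> - 1)) powr p"
      using \<theta>(1) by (simp add: powr_divide powr_minus_divide)
    also have "x powr (- p) * (1 / (\<theta> - 1)) powr p = (1 / (\<theta> - 1)) powr p * x powr (- p)"
      by (rule mult.commute)
    also have "2 * \<dots> \<le> C * x powr (- p)"
      unfolding mult.assoc[symmetric] by (intro mult_right_mono) (auto simp: C_def)
    finally have "1 / 2 ^ k * ?f u \<le> C * x powr (- p) * ?f u"
      using tail_nonneg by (rule mult_right_mono)
    with 1 show ?thesis by simp
  qed
  then have "eventually (\<lambda>u. \<forall>x>0. ?f (u + x / w u) \<le> C * x powr (- p) * ?f u) (up_to r)"
    unfolding eventually_up_to[OF upper_endpoint_neq_MInf] using a(1) by blast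
  moreover have "1 \<le> C" by (simp add: C_def)
  ultimately show thesis using that by blast
qed

end

section \<open>The tail of a product\<close>

text \<open>The limit constant of the Gumbel case: under \<open>y = exp (- z)\<close> this is Euler's integral.\<close>

lemma integral_minus_ln_powr:
  fixes \<alpha> :: real
  assumes "0 \<le> \<alpha>"
  shows "(LBINT y:{0<..<1}. (- ln y) powr \<alpha>) = Gamma (\<alpha> + 1)"
proof -
  have image: "(\<lambda>z. exp (- z)) ` {0<..} = {0<..<1::real}"
  proof (intro equalityI subsetI)
    fix y :: real assume y: "y \<in> {0<..<1}"
    then have "y = exp (- (- ln y))" "- ln y \<in> {0<..}" by auto
    then show "y \<in> (\<lambda>z. exp (- z)) ` {0<..}" by blast
  qed auto
  have "((\<lambda>t. t powr \<alpha> / exp t) has_integral Gamma (\<alpha> + 1)) {0..}"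
    using Gamma_integral_real[of "\<alpha> + 1"] assms by simp
  then have *: "((\<lambda>t. t powr \<alpha> / exp t) has_integral Gamma (\<alpha> + 1)) {0<..}"
    by (subst (asm) has_integral_spike_set_eq[where T = "{0<..}"])
       (auto intro!: negligible_subset[OF negligible_sing[of "0::real"]])
  then have "(\<lambda>t. t powr \<alpha> / exp t) absolutely_integrable_on {0<..}"
    by (intro nonnegative_absolutely_integrable_1) (auto simp: has_integral_iff)
  moreover have "(\<lambda>z. \<bar>- exp (- z)\<bar> * (- ln (exp (- z))) powr \<alpha>) = (\<lambda>z. z powr \<alpha> / exp z)"
    by (simp add: exp_minus divide_inverse mult.commute del: ln_exp) (simp add: exp_minus[symmetric])
  ultimately have "(\<lambda>z. \<bar>- exp (- z)\<bar> * (- ln (exp (- z))) powr \<alpha>) absolutely_integrable_on {0<..} \<and>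
      integral {0<..} (\<lambda>z. \<bar>- exp (- z)\<bar> * (- ln (exp (- z))) powr \<alpha>) = Gamma (\<alpha> + 1)"
    using * by (simp only: has_integral_iff)
  then have abs: "(\<lambda>y. (- ln y) powr \<alpha>) absolutely_integrable_on {0<..<1} \<and>
      integral {0<..<1} (\<lambda>y. (- ln y) powr \<alpha>) = Gamma (\<alpha> + 1)"
    by (subst (asm) has_absolute_integral_change_of_variables_1')
       (auto intro!: derivative_eq_intros inj_onI simp: image)
  have "set_integrable lborel {0<..<1} (\<lambda>y. (- ln y) powr \<alpha>)"
    using abs unfolding set_integrable_def
    by (subst (asm) integrable_completion) auto
  from set_borel_integral_eq_integral(2)[OF this] abs show ?thesis by simp
qed

lemma set_integrable_powr_unit:
  fixes a K :: real
  assumes "- 1 < a"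
  shows "set_integrable lborel {0<..<1} (\<lambda>y. K * y powr a)"
proof -
  have "(\<lambda>y. y powr a) integrable_on {0<..1::real}"
    using integrable_on_powr_from_0'[OF assms, of 1] by simp
  then have "(\<lambda>y. y powr a) absolutely_integrable_on {0<..1::real}"
    by (intro nonnegative_absolutely_integrable_1) auto
  then have "set_integrable lborel {0<..1::real} (\<lambda>y. y powr a)"
    unfolding set_integrable_def by (subst (asm) integrable_completion) auto
  then have "set_integrable lborel {0<..<1::real} (\<lambda>y. y powr a)"
    by (rule set_integrable_subset) auto
  then show ?thesis by (rule set_integrable_mult_right)
qed

text \<open>The integral is the tail of the product of independent factors with laws \<open>M\<close> and \<open>N\<close>.  Put
  \<open>s = u * w u\<close>.  For \<open>t = 1 - x / s\<close> the point \<open>u / t\<close> is about \<open>u + x / w u\<close>, so the ratio of the tail at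
  \<open>u / t\<close> to the tail at \<open>u\<close> tends to \<open>exp (- x)\<close> and exceeds \<open>y\<close> for \<open>x\<close> up to \<open>- ln y\<close>.\<close>

lemma (in gumbel_distribution) product_tail_gumbel:
  assumes N: "real_distribution N" and supp: "AE t in N. t \<in> {0<..<1}"
    and rv: "tail_regularly_varying_at_1 (cdf N) \<alpha>" and \<alpha>: "0 \<le> \<alpha>"
  shows "((\<lambda>u. (\<integral>t. tail (cdf M) (u / t) \<partial>N) /
      (Gamma (\<alpha> + 1) * tail (cdf N) (1 - 1 / (u * w u)) * tail (cdf M) u)) \<longlongrightarrow> 1) (up_to r)"
proof (rule tendsto_up_to_sequentially[OF upper_endpoint_neq_MInf])
  interpret N: real_distribution N by fact
  let ?f = "tail (cdf M)"
  fix X :: "nat \<Rightarrow> real" assume X: "filterlim X (up_to r) sequentially"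
  note along = filterlim_iff[THEN iffD1, OF X, rule_format]
  define s where "s n = X n * w (X n)" for n
  define \<phi> where "\<phi> n t = ?f (X n / t) / ?f (X n)" for n t
  \<comment> \<open>With this decay rate the two power bounds combine to the integrable dominating function
    \<open>y powr (- (1 / 2))\<close>.\<close>
  define p where "p = 2 * (\<alpha> + 1)"
  have p: "0 < p" using \<alpha> by (simp add: p_def)
  have s: "filterlim s at_top sequentially"
    unfolding s_def using filterlim_compose[OF u_w_at_top X] .
  have \<phi>_lim: "(\<lambda>n. \<phi> n (1 - x / s n)) \<longlonglongrightarrow> exp (- x)" for x
  proof -
    \<comment> \<open>\<open>X n / (1 - x / s n)\<close> is a shift of \<open>X n\<close> by exactly \<open>x / (1 - x / s n)\<close> units \<open>1 / w (X n)\<close>.\<close>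
    have "(\<lambda>n. x / s n) \<longlonglongrightarrow> 0"
      using s by (intro real_tendsto_divide_at_top[where f = "\<lambda>_. x"]) auto
    then have "(\<lambda>n. x / (1 - x / s n)) \<longlonglongrightarrow> x / (1 - 0)"
      by (intro tendsto_intros) auto
    then have xi: "(\<lambda>n. x / (1 - x / s n)) \<longlonglongrightarrow> x" by simp
    have "(\<lambda>n. ?f (X n + (x / (1 - x / s n)) / w (X n)) / ?f (X n)) \<longlonglongrightarrow> exp (- x)"
    proof (rule antimono_tendsto_moving_argument[OF _ _ _ xi, where h = "\<lambda>x. exp (- x)"
          and g = "\<lambda>n x. ?f (X n + x / w (X n)) / ?f (X n)"])
      show "\<forall>\<^sub>F n in sequentially. antimono (\<lambda>x. ?f (X n + x / w (X n)) / ?f (X n))"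
        using along[OF ev_w_pos] along[OF ev_tail_pos]
        by eventually_elim (auto intro!: antimonoI divide_right_mono tail_antimono)
      show "(\<lambda>n. ?f (X n + x / w (X n)) / ?f (X n)) \<longlonglongrightarrow> exp (- x)" for x
        using filterlim_compose[OF tail_ratio X] .
    qed simp
    moreover have "\<forall>\<^sub>F n in sequentially. s n > \<bar>x\<bar>"
      using s by (simp add: filterlim_at_top_dense)
    then have "\<forall>\<^sub>F n in sequentially. ?f (X n + (x / (1 - x / s n)) / w (X n)) / ?f (X n) = \<phi> n (1 - x / s n)"
      using along[OF ev_w_pos] along[OF ev_pos]
    proof eventually_elim
      case (elim n)
      have "X n / (1 - x / s n) = X n + (x / (1 - x / s n)) / w (X n)"
        using elim by (simp add: s_def field_simps)
      then show ?case by (simp add: \<phi>_def)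
    qed
    ultimately show ?thesis by (rule Lim_transform_eventually)
  qed
  obtain C where C: "1 \<le> C"
    "eventually (\<lambda>u. \<forall>x>0. ?f (u + x / w u) \<le> C * x powr (- p) * ?f u) (up_to r)"
    using tail_power_bound[OF p] by blast
  obtain C' s0 where C': "0 < C'" "0 < s0"
    "\<And>s x. s0 \<le> s \<Longrightarrow> 1 \<le> x \<Longrightarrow> tail (cdf N) (1 - x / s) \<le> C' * x powr (\<alpha> + 1) * tail (cdf N) (1 - 1 / s)"
    using N.tail_regularly_varying_at_1_power_bound[OF rv \<alpha>] by blast
  have "(\<lambda>n. (\<integral>t. \<phi> n t \<partial>N) / tail (cdf N) (1 - 1 / s n)) \<longlonglongrightarrow> (LBINT y:{0<..<1}. (- ln y) powr \<alpha>)"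
  proof (rule N.regular_variation_integral_limit[OF rv supp s])
    show "\<phi> n \<in> borel_measurable borel" for n
      unfolding \<phi>_def by measurable
    show "\<forall>\<^sub>F n in sequentially. mono_on {0<..<1} (\<phi> n) \<and> \<phi> n ` {0<..<1} \<subseteq> {0..1}"
      using along[OF ev_tail_pos] along[OF ev_pos]
    proof eventually_elim
      case (elim n)
      have "mono_on {0<..<1} (\<phi> n)"
        using elim by (auto intro!: mono_onI divide_right_mono tail_antimono divide_left_mono simp: \<phi>_def)
      moreover have "\<phi> n t \<in> {0..1}" if "t \<in> {0<..<1}" for t
      proof -
        have "X n \<le> X n / t" using that elim by (simp add: field_simps)
        then have "?f (X n / t) \<le> ?f (X n)" by (rule tail_antimono)
        then show ?thesis using elim tail_nonneg by (auto simp: \<phi>_def)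
      qed
      ultimately show ?case by blast
    qed
    fix x y :: real assume y: "y \<in> {0<..<1}"
    show "\<forall>\<^sub>F n in sequentially. y < \<phi> n (1 - x / s n)" if "x < - ln y"
    proof -
      have "exp (ln y) < exp (- x)" using that by (subst exp_less_cancel_iff) simp
      then show ?thesis
        using y by (intro order_tendstoD(1)[OF \<phi>_lim]) (simp del: exp_less_cancel_iff)
    qed
    show "\<forall>\<^sub>F n in sequentially. \<phi> n (1 - x / s n) \<le> y" if "- ln y < x"
    proof -
      have "exp (- x) < exp (ln y)" using that by (subst exp_less_cancel_iff) simp
      then have "\<forall>\<^sub>F n in sequentially. \<phi> n (1 - x / s n) < y"
        using y by (intro order_tendstoD(2)[OF \<phi>_lim]) (simp del: exp_less_cancel_iff)
      then show ?thesis by eventually_elim simp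
    qed
  next
    have "\<forall>\<^sub>F n in sequentially. s n \<ge> s0"
      using s by (simp add: filterlim_at_top)
    then show "\<forall>\<^sub>F n in sequentially. \<forall>y\<in>{0<..<1}.
        measure N {t. y < \<phi> n t} / tail (cdf N) (1 - 1 / s n) \<le> C' * C powr (1 / 2) * y powr (- (1 / 2))"
      using along[OF C(2)] along[OF ev_tail_pos] along[OF ev_pos] along[OF ev_w_pos]
    proof eventually_elim
      case (elim n)
      show ?case
      proof
        fix y :: real assume y: "y \<in> {0<..<1}"
        \<comment> \<open>The bound \<open>C * x powr (- p)\<close> falls to the level \<open>y\<close> at \<open>x = z\<close>.\<close>
        define z where "z = (C / y) powr (1 / p)"
        have Cy: "1 \<le> C / y" using C(1) y by (simp add: field_simps)
        have z: "1 \<le> z" unfolding z_def using Cy p by (intro ge_one_powr_ge_zero) auto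
        have "measure N {t. y < \<phi> n t} \<le> tail (cdf N) (1 - z / s n)"
          unfolding N.tail_cdf
        proof (rule N.finite_measure_mono_AE)
          show "AE t in N. t \<in> {t. y < \<phi> n t} \<longrightarrow> t \<in> {1 - z / s n<..}"
            using supp
          proof (eventually_elim, intro impI)
            fix t assume t: "t \<in> {0<..<1}" and "t \<in> {t. y < \<phi> n t}"
            define x where "x = s n * (1 - t)"
            have sn: "0 < s n" using elim C'(2) by simp
            have x: "0 < x" using sn t by (simp add: x_def)
            have "X n * (1 - t) * t \<le> X n * (1 - t) * 1"
              using t elim by (intro mult_left_mono) auto
            then have "X n * (1 - t) \<le> X n * (1 - t) / t"
              using t by (simp add: field_simps)
            then have "X n + X n * (1 - t) \<le> X n / t"
              using t by (simp add: field_simps)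
            moreover have "x / w (X n) = X n * (1 - t)"
              using elim by (simp add: x_def s_def)
            ultimately have "X n + x / w (X n) \<le> X n / t"
              by simp
            then have "?f (X n / t) \<le> ?f (X n + x / w (X n))" by (rule tail_antimono)
            also have "\<dots> \<le> C * x powr (- p) * ?f (X n)" using elim x by blast
            finally have "\<phi> n t \<le> C * x powr (- p)"
              using elim by (simp add: \<phi>_def field_simps)
            with \<open>t \<in> {t. y < \<phi> n t}\<close> have "y < C * x powr (- p)" by simp
            then have "x powr p < C / y"
              using x y by (simp add: powr_minus field_simps)
            then have "(x powr p) powr (1 / p) < z"
              unfolding z_def using p by (intro powr_less_mono2) auto
            then have "x < z" using x p by (simp add: powr_powr)
            then show "t \<in> {1 - z / s n<..}"
              using sn by (simp add: x_def field_simps)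
          qed
        qed (simp add: \<phi>_def)
        also have "\<dots> \<le> C' * z powr (\<alpha> + 1) * tail (cdf N) (1 - 1 / s n)"
          using C'(3) elim z by blast
        also have "z powr (\<alpha> + 1) = (C / y) powr (1 / p * (\<alpha> + 1))"
          by (simp add: z_def powr_powr)
        also have "1 / p * (\<alpha> + 1) = 1 / 2"
          using \<alpha> by (simp add: p_def divide_simps)
        also have "(C / y) powr (1 / 2) = C powr (1 / 2) * y powr (- (1 / 2))"
          using C(1) y by (simp add: powr_divide powr_minus field_simps)
        finally have le: "measure N {t. y < \<phi> n t} \<le>
          (C' * C powr (1 / 2) * y powr (- (1 / 2))) * tail (cdf N) (1 - 1 / s n)" by (simp add: mult_ac)
        show "measure N {t. y < \<phi> n t} / tail (cdf N) (1 - 1 / s n) \<le> C' * C powr (1 / 2) * y powr (- (1 / 2))"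
        proof (cases "tail (cdf N) (1 - 1 / s n) = 0")
          case False
          then have "0 < tail (cdf N) (1 - 1 / s n)" using N.tail_nonneg by (simp add: less_le)
          with le show ?thesis by (simp add: divide_le_eq)
        qed (use C' in simp)
      qed
    qed
    show "set_integrable lborel {0<..<1} (\<lambda>y. C' * C powr (1 / 2) * y powr (- (1 / 2)))"
      by (rule set_integrable_powr_unit) simp
  qed auto
  then have "(\<lambda>n. (\<integral>t. \<phi> n t \<partial>N) / tail (cdf N) (1 - 1 / s n) / Gamma (\<alpha> + 1)) \<longlonglongrightarrow> Gamma (\<alpha> + 1) / Gamma (\<alpha> + 1)"
    unfolding integral_minus_ln_powr[OF \<alpha>] by (rule tendsto_divide) (use \<alpha> in \<open>auto intro!: tendsto_intros simp: Gamma_eq_zero_iff elim!: nonpos_Ints_cases\<close>)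
  moreover have "0 < Gamma (\<alpha> + 1)" using \<alpha> by (intro Gamma_real_pos) simp
  ultimately show "(\<lambda>n. (\<integral>t. ?f (X n / t) \<partial>N) / (Gamma (\<alpha> + 1) * tail (cdf N) (1 - 1 / (X n * w (X n))) * ?f (X n))) \<longlonglongrightarrow> 1"
    by (simp add: \<phi>_def s_def mult_ac)
qed

text \<open>The limit constant for two regularly varying factors.  The substitution \<open>y = z powr \<gamma>\<close> turns it into
  a Beta integral.  For \<open>\<gamma> = 0\<close> the rescaled tail of the first factor tends to a jump from \<open>1\<close> to \<open>0\<close> at \<open>x = 1\<close>, so
  every level \<open>y\<close> is crossed at \<open>1\<close>.\<close>

lemma integral_one_minus_root_powr:
  fixes \<alpha> \<gamma> :: real
  assumes \<alpha>: "0 \<le> \<alpha>" and \<gamma>: "0 \<le> \<gamma>"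
  shows "(LBINT y:{0<..<1}. (if \<gamma> = 0 then 1 else 1 - y powr (1 / \<gamma>)) powr \<alpha>)
    = Gamma (\<gamma> + 1) * Gamma (\<alpha> + 1) / Gamma (\<gamma> + \<alpha> + 1)"
proof (cases "\<gamma> = 0")
  case True
  have "Gamma (\<alpha> + 1) > 0" using \<alpha> by (intro Gamma_real_pos) simp
  then show ?thesis using True by (simp add: set_lebesgue_integral_def add.commute)
next
  case False
  with \<gamma> have \<gamma>: "0 < \<gamma>" by simp
  have image: "(\<lambda>z. z powr \<gamma>) ` {0<..<1} = {0<..<1::real}"
  proof (intro equalityI subsetI)
    fix y :: real assume y: "y \<in> {0<..<1}"
    then have "y = (y powr (1 / \<gamma>)) powr \<gamma>" "y powr (1 / \<gamma>) \<in> {0<..<1}"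
      using \<gamma> powr_less_mono2[of "1 / \<gamma>" y 1] by (auto simp: powr_powr)
    then show "y \<in> (\<lambda>z. z powr \<gamma>) ` {0<..<1}" by blast
  next
    fix y :: real assume "y \<in> (\<lambda>z. z powr \<gamma>) ` {0<..<1}"
    then show "y \<in> {0<..<1}"
      using \<gamma> powr_less_mono2[of \<gamma> _ 1] by auto
  qed
  have "((\<lambda>z. \<gamma> * (z powr (\<gamma> - 1) * (1 - z) powr \<alpha>)) has_integral \<gamma> * Beta \<gamma> (\<alpha> + 1)) {0<..<1}"
    using has_integral_Beta_real[of \<gamma> "\<alpha> + 1"] \<gamma> \<alpha>
    by (intro has_integral_mult_right) (simp add: has_integral_Icc_iff_Ioo)
  moreover have "(\<lambda>z. \<gamma> * (z powr (\<gamma> - 1) * (1 - z) powr \<alpha>)) absolutely_integrable_on {0<..<1}"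
    using calculation \<gamma> by (intro nonnegative_absolutely_integrable_1) (auto simp: has_integral_iff)
  ultimately have 1: "(\<lambda>z. \<gamma> * (z powr (\<gamma> - 1) * (1 - z) powr \<alpha>)) absolutely_integrable_on {0<..<1} \<and>
      integral {0<..<1} (\<lambda>z. \<gamma> * (z powr (\<gamma> - 1) * (1 - z) powr \<alpha>)) = \<gamma> * Beta \<gamma> (\<alpha> + 1)"
    by (simp only: has_integral_iff)
  have eq: "\<bar>\<gamma> * z powr (\<gamma> - 1)\<bar> * (1 - (z powr \<gamma>) powr (1 / \<gamma>)) powr \<alpha>
      = \<gamma> * (z powr (\<gamma> - 1) * (1 - z) powr \<alpha>)" if "z \<in> {0<..<1}" for z
    using that \<gamma> by (simp add: powr_powr abs_mult)
  have L: "(\<lambda>z. \<bar>\<gamma> * z powr (\<gamma> - 1)\<bar> * (1 - (z powr \<gamma>) powr (1 / \<gamma>)) powr \<alpha>) absolutely_integrable_on {0<..<1} \<and>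
      integral {0<..<1} (\<lambda>z. \<bar>\<gamma> * z powr (\<gamma> - 1)\<bar> * (1 - (z powr \<gamma>) powr (1 / \<gamma>)) powr \<alpha>) = \<gamma> * Beta \<gamma> (\<alpha> + 1)"
    (is ?L)
    using 1 eq by (metis (mono_tags, lifting) integral_cong set_integrable_cong)
  have "?L \<longleftrightarrow> (\<lambda>y. (1 - y powr (1 / \<gamma>)) powr \<alpha>) absolutely_integrable_on (\<lambda>z. z powr \<gamma>) ` {0<..<1} \<and>
      integral ((\<lambda>z. z powr \<gamma>) ` {0<..<1}) (\<lambda>y. (1 - y powr (1 / \<gamma>)) powr \<alpha>) = \<gamma> * Beta \<gamma> (\<alpha> + 1)"
  proof (rule has_absolute_integral_change_of_variables_1')
    show "((\<lambda>z. z powr \<gamma>) has_real_derivative \<gamma> * z powr (\<gamma> - 1)) (at z within {0<..<1})"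
      if "z \<in> {0<..<1}" for z
      using that by (auto intro!: derivative_eq_intros simp: powr_diff)
    show "inj_on (\<lambda>z. z powr \<gamma>) {0<..<1}"
      using \<gamma> by (intro inj_on_inverseI[where g = "\<lambda>y. y powr (1 / \<gamma>)"]) (auto simp: powr_powr)
  qed simp
  with L have abs: "(\<lambda>y. (1 - y powr (1 / \<gamma>)) powr \<alpha>) absolutely_integrable_on {0<..<1} \<and>
      integral {0<..<1} (\<lambda>y. (1 - y powr (1 / \<gamma>)) powr \<alpha>) = \<gamma> * Beta \<gamma> (\<alpha> + 1)"
    by (simp only: image)
  have int: "set_integrable lborel {0<..<1} (\<lambda>y. (1 - y powr (1 / \<gamma>)) powr \<alpha>)"
    using abs unfolding set_integrable_def
    by (subst (asm) integrable_completion) auto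
  have "\<gamma> * Beta \<gamma> (\<alpha> + 1) = Gamma (\<gamma> + 1) * Gamma (\<alpha> + 1) / Gamma (\<gamma> + \<alpha> + 1)"
  proof -
    have "\<gamma> \<notin> \<int>\<^sub>\<le>\<^sub>0" using \<gamma> by (auto elim: nonpos_Ints_cases)
    then show ?thesis by (simp add: Gamma_plus1 Beta_def add.assoc)
  qed
  with set_borel_integral_eq_integral(2)[OF int] abs \<gamma> show ?thesis by simp
qed

text \<open>For \<open>t = 1 - x / s\<close> with \<open>u = 1 - 1 / s\<close> the point \<open>u / t\<close> is about \<open>1 - (1 - x) / s\<close>, so the
  ratio of the tail at \<open>u / t\<close> to the tail at \<open>u\<close> tends to \<open>(1 - x) powr \<gamma>\<close> for \<open>x < 1\<close> and is \<open>0\<close> for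
  \<open>x > 1\<close>.  Domination is trivial, as only \<open>t > u\<close> contributes.\<close>

lemma (in real_distribution) product_tail_regularly_varying:
  assumes rvM: "tail_regularly_varying_at_1 (cdf M) \<gamma>" and \<gamma>: "0 \<le> \<gamma>" and M1: "tail (cdf M) 1 = 0"
    and N: "real_distribution N" and supp: "AE t in N. t \<in> {0<..<1}"
    and rv: "tail_regularly_varying_at_1 (cdf N) \<alpha>" and \<alpha>: "0 \<le> \<alpha>"
  shows "((\<lambda>u. (\<integral>t. tail (cdf M) (u / t) \<partial>N) / (tail (cdf M) u * tail (cdf N) u))
    \<longlongrightarrow> Gamma (\<gamma> + 1) * Gamma (\<alpha> + 1) / Gamma (\<gamma> + \<alpha> + 1)) (at_left 1)"
proof -
  interpret N: real_distribution N by fact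
  let ?f = "tail (cdf M)"
  define q where "q y = (if \<gamma> = 0 then 1 else 1 - y powr (1 / \<gamma>))" for y
  have M1': "?f x = 0" if "1 \<le> x" for x
    using tail_antimono[OF that] tail_nonneg[of x] M1 by simp
  have at_left: "at_left (1::real) = up_to (ereal 1)" by (simp add: up_to_def)
  show ?thesis
    unfolding at_left
  proof (rule tendsto_up_to_sequentially)
    fix X :: "nat \<Rightarrow> real" assume "filterlim X (up_to (ereal 1)) sequentially"
    then have X: "filterlim X (at_left 1) sequentially" by (simp add: at_left)
    define s where "s n = 1 / (1 - X n)" for n
    have X_s: "X n = 1 - 1 / s n" for n by (simp add: s_def)
    define \<phi> where "\<phi> n t = ?f (X n / t) / ?f (X n)" for n t
    have X01: "\<forall>\<^sub>F n in sequentially. 0 < X n \<and> X n < 1"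
    proof -
      have "\<forall>\<^sub>F x in at_left 1. 0 < x \<and> x < (1::real)"
        by (auto simp: eventually_at_left[of 0] intro!: exI[of _ 0])
      with X show ?thesis by (auto simp: filterlim_iff)
    qed
    have s: "filterlim s at_top sequentially"
    proof -
      have "(\<lambda>n. 1 - X n) \<longlonglongrightarrow> 1 - 1"
        by (intro tendsto_intros) (use X in \<open>simp add: filterlim_at\<close>)
      then have "filterlim (\<lambda>n. inverse (1 - X n)) at_top sequentially"
        by (intro filterlim_inverse_at_top) (use X01 in \<open>auto elim!: eventually_mono\<close>)
      then show ?thesis by (simp add: s_def[abs_def] inverse_eq_divide)
    qed
    have fpos: "\<forall>\<^sub>F n in sequentially. 0 < ?f (X n)"
      using filterlim_iff[THEN iffD1, OF s, rule_format, OF tail_regularly_varying_at_1_pos[OF rvM tail_nonneg]]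
      by (simp add: X_s)
    have \<phi>_lim: "(\<lambda>n. \<phi> n (1 - x / s n)) \<longlonglongrightarrow> (1 - x) powr \<gamma>" if x: "x < 1" for x
    proof -
      have "(\<lambda>n. x / s n) \<longlonglongrightarrow> 0"
        using s by (intro real_tendsto_divide_at_top[where f = "\<lambda>_. x"]) auto
      then have "(\<lambda>n. (1 - x) / (1 - x / s n)) \<longlonglongrightarrow> (1 - x) / (1 - 0)"
        by (intro tendsto_intros) auto
      then have "(\<lambda>n. (1 - x) / (1 - x / s n)) \<longlonglongrightarrow> 1 - x" by simp
      then have "(\<lambda>n. ?f (1 - ((1 - x) / (1 - x / s n)) / s n) / ?f (1 - 1 / s n)) \<longlonglongrightarrow> (1 - x) powr \<gamma>"
        by (rule tail_regularly_varying_at_1_moving[OF rvM s]) (use x in simp)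
      moreover have "\<forall>\<^sub>F n in sequentially. s n > \<bar>x\<bar>"
        using s by (simp add: filterlim_at_top_dense)
      then have "\<forall>\<^sub>F n in sequentially.
          ?f (1 - ((1 - x) / (1 - x / s n)) / s n) / ?f (1 - 1 / s n) = \<phi> n (1 - x / s n)"
      proof eventually_elim
        case (elim n)
        have "s n \<noteq> 0" "s n \<noteq> x" using elim by auto
        then have "1 - x / s n \<noteq> 0" by (simp add: field_simps)
        moreover have "1 - 1 / s n = (1 - x / s n) - (1 - x) / s n"
          by (simp add: diff_divide_distrib)
        ultimately have "(1 - 1 / s n) / (1 - x / s n) = 1 - (1 - x) / s n / (1 - x / s n)"
          by (metis diff_divide_distrib divide_self)
        then have "(1 - 1 / s n) / (1 - x / s n) = 1 - ((1 - x) / (1 - x / s n)) / s n"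
          by (simp add: mult.commute)
        then show ?case by (simp add: \<phi>_def X_s)
      qed
      ultimately show ?thesis by (rule Lim_transform_eventually)
    qed
    have mono: "\<forall>\<^sub>F n in sequentially. mono_on {0<..<1} (\<phi> n) \<and> \<phi> n ` {0<..<1} \<subseteq> {0..1}"
      using X01 fpos
    proof eventually_elim
      case (elim n)
      have "mono_on {0<..<1} (\<phi> n)"
        using elim by (auto intro!: mono_onI divide_right_mono tail_antimono divide_left_mono simp: \<phi>_def)
      moreover have "\<phi> n t \<in> {0..1}" if "t \<in> {0<..<1}" for t
      proof -
        have "X n \<le> X n / t" using that elim by (simp add: field_simps)
        then have "?f (X n / t) \<le> ?f (X n)" by (rule tail_antimono)
        then show ?thesis using elim tail_nonneg by (auto simp: \<phi>_def)
      qed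
      ultimately show ?case by blast
    qed
    have q_le_1: "q y \<le> 1" for y by (simp add: q_def)
    have "(\<lambda>n. (\<integral>t. \<phi> n t \<partial>N) / tail (cdf N) (1 - 1 / s n)) \<longlonglongrightarrow> (LBINT y:{0<..<1}. q y powr \<alpha>)"
    proof (rule N.regular_variation_integral_limit[OF rv supp s _ mono])
      show "\<phi> n \<in> borel_measurable borel" for n
        unfolding \<phi>_def by measurable
      show "q \<in> borel_measurable borel"
        unfolding q_def by measurable
      fix y :: real assume y: "y \<in> {0<..<1}"
      have root: "y powr (1 / \<gamma>) < 1" if "0 < \<gamma>"
        using that y powr_less_mono2[of "1 / \<gamma>" y 1] by auto
      show "0 < q y"
        using root \<gamma> by (auto simp: q_def)
      show "\<forall>\<^sub>F n in sequentially. y < \<phi> n (1 - x / s n)" if x: "0 < x" "x < q y" for x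
      proof -
        have x1: "x < 1" using x q_le_1[of y] by linarith
        have "y < (1 - x) powr \<gamma>"
        proof (cases "\<gamma> = 0")
          case False
          then have "y powr (1 / \<gamma>) < 1 - x" using x by (simp add: q_def)
          then have "(y powr (1 / \<gamma>)) powr \<gamma> < (1 - x) powr \<gamma>"
            using \<gamma> False by (intro powr_less_mono2) auto
          then show ?thesis using y False by (simp add: powr_powr)
        qed (use x1 y in simp)
        then show ?thesis by (rule order_tendstoD(1)[OF \<phi>_lim[OF x1]])
      qed
      show "\<forall>\<^sub>F n in sequentially. \<phi> n (1 - x / s n) \<le> y" if x: "q y < x" for x
      proof (cases "\<gamma> = 0")
        case True
        then have x1: "1 < x" using x by (simp add: q_def)
        have "\<forall>\<^sub>F n in sequentially. s n > x"
          using s by (simp add: filterlim_at_top_dense)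
        then show ?thesis
        proof eventually_elim
          case (elim n)
          have "1 \<le> X n / (1 - x / s n)"
            using elim x1 unfolding X_s by (simp add: field_simps)
          then show ?case using y by (simp add: \<phi>_def M1')
        qed
      next
        case False
        then have "q y < min 1 x" using x \<gamma> y by (simp add: q_def)
        then obtain x' where x': "q y < x'" "x' < min 1 x" using dense by blast
        have "0 < q y" using root \<gamma> by (auto simp: q_def)
        have "1 - x' < y powr (1 / \<gamma>)" using x' False by (simp add: q_def)
        then have "(1 - x') powr \<gamma> < (y powr (1 / \<gamma>)) powr \<gamma>"
          using \<gamma> False x' by (intro powr_less_mono2) auto
        then have "(1 - x') powr \<gamma> < y" using y False by (simp add: powr_powr)
        then have "\<forall>\<^sub>F n in sequentially. \<phi> n (1 - x' / s n) < y"
          using x' by (intro order_tendstoD(2)[OF \<phi>_lim]) auto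
        moreover have "\<forall>\<^sub>F n in sequentially. s n > x"
          using s by (simp add: filterlim_at_top_dense)
        ultimately show ?thesis
          using mono
        proof eventually_elim
          case (elim n)
          have "\<phi> n (1 - x / s n) \<le> \<phi> n (1 - x' / s n)"
            using elim x' \<open>0 < q y\<close>
            by (intro mono_onD[of "{0<..<1}" "\<phi> n"]) (auto simp: divide_right_mono)
          with elim show ?case by linarith
        qed
      qed
    next
      show "\<forall>\<^sub>F n in sequentially. \<forall>y\<in>{0<..<1}.
          measure N {t. y < \<phi> n t} / tail (cdf N) (1 - 1 / s n) \<le> 1"
        using X01
      proof eventually_elim
        case (elim n)
        show ?case
        proof
          fix y :: real assume y: "y \<in> {0<..<1}"
          have "measure N {t. y < \<phi> n t} \<le> tail (cdf N) (X n)"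
            unfolding N.tail_cdf
          proof (rule N.finite_measure_mono_AE)
            show "AE t in N. t \<in> {t. y < \<phi> n t} \<longrightarrow> t \<in> {X n<..}"
              using supp
            proof eventually_elim
              case t: (elim t)
              have "\<phi> n t = 0" if "t \<le> X n"
                using that t elim by (simp add: \<phi>_def M1')
              then show ?case using y by force
            qed
          qed (simp add: \<phi>_def)
          then show "measure N {t. y < \<phi> n t} / tail (cdf N) (1 - 1 / s n) \<le> 1"
            using N.tail_nonneg[of "X n"] y by (simp add: X_s[symmetric] divide_le_eq_1 less_le)
        qed
      qed
      show "set_integrable lborel {0<..<1::real} (\<lambda>_. 1 :: real)"
        by (auto simp: set_integrable_def intro!: integrable_real_indicator)
    qed
    then show "(\<lambda>n. (\<integral>t. ?f (X n / t) \<partial>N) / (?f (X n) * tail (cdf N) (X n)))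
        \<longlonglongrightarrow> Gamma (\<gamma> + 1) * Gamma (\<alpha> + 1) / Gamma (\<gamma> + \<alpha> + 1)"
      by (simp add: \<phi>_def X_s[symmetric] q_def integral_one_minus_root_powr[OF \<alpha> \<gamma>])
  qed simp
qed

section \<open>Products of independent factors\<close>

definition product_law :: "real measure \<Rightarrow> real measure \<Rightarrow> real measure"
  where "product_law P Q = distr (P \<Otimes>\<^sub>M Q) borel (\<lambda>(x, t). x * t)"

lemma (in prob_space) distr_mult_eq_product_law:
  assumes "indep_var borel X borel Y"
  shows "distr M borel (\<lambda>\<omega>. X \<omega> * Y \<omega> :: real) = product_law (distr M borel X) (distr M borel Y)"
proof -
  have [measurable]: "random_variable borel X" "random_variable borel Y"
    and eq: "distr M borel X \<Otimes>\<^sub>M distr M borel Y = distr M (borel \<Otimes>\<^sub>M borel) (\<lambda>x. (X x, Y x))"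
    using assms unfolding indep_var_distribution_eq by auto
  show ?thesis
    unfolding product_law_def eq by (subst distr_distr) (auto simp: comp_def)
qed

lemma real_distribution_product_law:
  assumes "real_distribution P" "real_distribution Q"
  shows "real_distribution (product_law P Q)"
proof -
  interpret P: real_distribution P by fact
  interpret Q: real_distribution Q by fact
  interpret PQ: pair_prob_space P Q ..
  show ?thesis
    unfolding product_law_def by (rule PQ.real_distribution_distr) measurable
qed

lemma product_law_commute:
  assumes "real_distribution P" "real_distribution Q"
  shows "product_law P Q = product_law Q P"
proof -
  interpret P: real_distribution P by fact
  interpret Q: real_distribution Q by fact
  interpret PQ: pair_sigma_finite P Q ..
  show ?thesis
    unfolding product_law_def
    by (subst PQ.distr_pair_swap, subst distr_distr) (auto simp: comp_def case_prod_beta' mult.commute)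
qed

lemma tail_product_law:
  assumes "real_distribution P" "real_distribution Q" and pos: "AE t in Q. 0 < t"
  shows "tail (cdf (product_law P Q)) u = (\<integral>t. tail (cdf P) (u / t) \<partial>Q)"
proof -
  interpret P: real_distribution P by fact
  interpret Q: real_distribution Q by fact
  interpret PQ: pair_prob_space P Q ..
  have "{z \<in> space (borel \<Otimes>\<^sub>M borel). u < fst z * snd z} \<in> sets (borel \<Otimes>\<^sub>M borel)"
    by measurable
  also have "{z \<in> space (borel \<Otimes>\<^sub>M borel). u < fst z * snd z} = {(x, t). u < x * t}"
    by (auto simp: space_pair_measure)
  finally have [measurable]: "{(x, t). u < x * t} \<in> sets (borel \<Otimes>\<^sub>M borel)" .
  interpret K: real_distribution "product_law P Q"
    by (intro real_distribution_product_law assms)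
  have "ennreal (tail (cdf (product_law P Q)) u) = emeasure (product_law P Q) {u<..}"
    by (simp add: K.tail_cdf K.emeasure_eq_measure)
  also have "\<dots> = emeasure (P \<Otimes>\<^sub>M Q) ((\<lambda>(x, t). x * t) -` {u<..} \<inter> space (P \<Otimes>\<^sub>M Q))"
    unfolding product_law_def by (rule emeasure_distr) measurable
  also have "(\<lambda>(x, t). x * t) -` {u<..} \<inter> space (P \<Otimes>\<^sub>M Q) = {(x, t). u < x * t}"
    by (auto simp: space_pair_measure)
  also have "emeasure (P \<Otimes>\<^sub>M Q) {(x, t). u < x * t} = (\<integral>\<^sup>+t. emeasure P ((\<lambda>x. (x, t)) -` {(x, t). u < x * t}) \<partial>Q)"
    by (rule PQ.emeasure_pair_measure_alt2) measurable
  also have "\<dots> = (\<integral>\<^sup>+t. ennreal (tail (cdf P) (u / t)) \<partial>Q)"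
  proof (rule nn_integral_cong_AE, use pos in eventually_elim)
    case (elim t)
    have "(\<lambda>x. (x, t)) -` {(x, t). u < x * t} = {u / t<..}"
      using elim by (auto simp: field_simps)
    then show ?case by (simp add: P.tail_cdf P.emeasure_eq_measure)
  qed
  also have "\<dots> = ennreal (\<integral>t. tail (cdf P) (u / t) \<partial>Q)"
    by (rule nn_integral_eq_integral)
       (auto intro!: Q.integrable_const_bound[where B = 1] simp: P.tail_nonneg P.tail_le_1)
  finally show ?thesis
    by (subst (asm) ennreal_inj) (auto simp: K.tail_nonneg P.tail_nonneg)
qed

lemma filterlim_one_minus_at_left:
  fixes x :: real
  assumes "0 < x"
  shows "filterlim (\<lambda>u. 1 - x / u) (at_left 1) at_top"
proof -
  have "((\<lambda>u. 1 - x / u) \<longlongrightarrow> 1 - 0) at_top"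
    by (intro tendsto_diff tendsto_const real_tendsto_divide_at_top[OF tendsto_const filterlim_ident])
  moreover have "eventually (\<lambda>u. 1 - x / u < 1) at_top"
    using eventually_gt_at_top[of 0] by eventually_elim (use assms in simp)
  ultimately show ?thesis
    by (auto simp: filterlim_at elim!: eventually_mono)
qed

lemma tail_regularly_varying_at_1_pos_at_left:
  assumes "tail_regularly_varying_at_1 G \<alpha>" and "\<And>x. 0 \<le> tail G x"
  shows "eventually (\<lambda>v. 0 < tail G v) (at_left 1)"
proof -
  have "filterlim (\<lambda>v::real. inverse (1 - v)) at_top (at_left 1)"
  proof (rule filterlim_inverse_at_top)
    have "((\<lambda>v::real. 1 - v) \<longlongrightarrow> 1 - 1) (at_left 1)" by (intro tendsto_intros)
    then show "((\<lambda>v::real. 1 - v) \<longlongrightarrow> 0) (at_left 1)" by simp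
  qed (auto simp: eventually_at_left[of 0] intro!: exI[of _ 0])
  from filterlim_iff[THEN iffD1, OF this, rule_format, OF tail_regularly_varying_at_1_pos[OF assms]]
  show ?thesis by (simp add: inverse_eq_divide)
qed

lemma tail_regularly_varying_at_1_asymp:
  assumes lim: "((\<lambda>u. tail K u / (tail F u * tail G u)) \<longlongrightarrow> c) (at_left 1)" "c \<noteq> 0"
    and F: "tail_regularly_varying_at_1 F \<gamma>" "\<And>x. 0 \<le> tail F x"
    and G: "tail_regularly_varying_at_1 G \<alpha>" "\<And>x. 0 \<le> tail G x"
  shows "tail_regularly_varying_at_1 K (\<gamma> + \<alpha>)"
  unfolding tail_regularly_varying_at_1_def
proof (intro allI impI)
  fix x :: real assume x: "0 < x"
  let ?p = "\<lambda>u. tail F u * tail G u"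
  have pos: "eventually (\<lambda>u. 0 < ?p (1 - y / u)) at_top" if "0 < y" for y
    using filterlim_iff[THEN iffD1, OF filterlim_one_minus_at_left[OF that], rule_format,
        OF tail_regularly_varying_at_1_pos_at_left[OF F]]
      filterlim_iff[THEN iffD1, OF filterlim_one_minus_at_left[OF that], rule_format,
        OF tail_regularly_varying_at_1_pos_at_left[OF G]]
    by eventually_elim simp
  have q: "((\<lambda>u. tail K (1 - y / u) / ?p (1 - y / u)) \<longlongrightarrow> c) at_top" if "0 < y" for y
    using filterlim_compose[OF lim(1) filterlim_one_minus_at_left[OF that]] .
  have "((\<lambda>u. (tail K (1 - x / u) / ?p (1 - x / u)) / (tail K (1 - 1 / u) / ?p (1 - 1 / u)) *
      ((tail F (1 - x / u) / tail F (1 - 1 / u)) * (tail G (1 - x / u) / tail G (1 - 1 / u))))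
      \<longlongrightarrow> c / c * (x powr \<gamma> * x powr \<alpha>)) at_top"
    using F(1) G(1) x lim(2) unfolding tail_regularly_varying_at_1_def
    by (intro tendsto_mult tendsto_divide q) auto
  moreover have "eventually (\<lambda>u. (tail K (1 - x / u) / ?p (1 - x / u)) / (tail K (1 - 1 / u) / ?p (1 - 1 / u)) *
      ((tail F (1 - x / u) / tail F (1 - 1 / u)) * (tail G (1 - x / u) / tail G (1 - 1 / u)))
      = tail K (1 - x / u) / tail K (1 - 1 / u)) at_top"
    using pos[OF x] pos[OF zero_less_one] by eventually_elim (auto simp: field_simps)
  ultimately show "((\<lambda>u. tail K (1 - x / u) / tail K (1 - 1 / u)) \<longlongrightarrow> x powr (\<gamma> + \<alpha>)) at_top"
    using lim(2) by (auto simp: powr_add intro: Lim_transform_eventually)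
qed

text \<open>Multiplying by one more factor multiplies the constant by
  \<open>Gamma (a + 1) * Gamma (\<alpha> j + 1) / Gamma (a + \<alpha> j + 1)\<close>, where \<open>a\<close> is the index reached so far; the
  product telescopes.  The empty product is the constant \<open>1\<close>, whose tail is slowly varying at \<open>1\<close>.\<close>

lemma (in prob_space) tail_prod_regularly_varying:
  fixes S :: "'i \<Rightarrow> 'a \<Rightarrow> real" and \<alpha> :: "'i \<Rightarrow> real"
  assumes "finite I" and "indep_vars (\<lambda>_. borel) S I"
    and "\<And>i \<omega>. i \<in> I \<Longrightarrow> \<omega> \<in> space M \<Longrightarrow> S i \<omega> \<in> {0<..<1}"
    and "\<And>i. i \<in> I \<Longrightarrow> 0 \<le> \<alpha> i"
    and "\<And>i. i \<in> I \<Longrightarrow> tail_regularly_varying_at_1 (cdf (distr M borel (S i))) (\<alpha> i)"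
  shows "tail_regularly_varying_at_1 (cdf (distr M borel (\<lambda>\<omega>. \<Prod>i\<in>I. S i \<omega>))) (\<Sum>i\<in>I. \<alpha> i) \<and>
    ((\<lambda>u. tail (cdf (distr M borel (\<lambda>\<omega>. \<Prod>i\<in>I. S i \<omega>))) u /
      ((\<Prod>i\<in>I. Gamma (\<alpha> i + 1) * tail (cdf (distr M borel (S i))) u) / Gamma ((\<Sum>i\<in>I. \<alpha> i) + 1)))
      \<longlongrightarrow> 1) (at_left 1)"
  using assms
proof (induction I rule: finite_induct)
  case empty
  interpret D: real_distribution "distr M borel (\<lambda>_. 1 :: real)"
    by (rule real_distribution_distr) simp
  have one: "tail (cdf (distr M borel (\<lambda>_. 1))) u = 1" if "u < 1" for u :: real
    unfolding D.tail_cdf using that by (simp add: measure_return)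
  have one': "eventually (\<lambda>u. tail (cdf (distr M borel (\<lambda>_. 1))) u = 1) (at_left 1)"
  proof -
    have "eventually (\<lambda>u::real. u < 1) (at_left 1)" by (simp add: eventually_at_filter)
    then show ?thesis by eventually_elim (rule one)
  qed
  have "tail_regularly_varying_at_1 (cdf (distr M borel (\<lambda>_. 1 :: real))) 0"
    unfolding tail_regularly_varying_at_1_def
  proof (intro allI impI)
    fix x :: real assume x: "0 < x"
    have "eventually (\<lambda>u. 1 = tail (cdf (distr M borel (\<lambda>_. 1))) (1 - x / u) /
        tail (cdf (distr M borel (\<lambda>_. 1))) (1 - 1 / u)) at_top"
      using eventually_gt_at_top[of 0]
    proof eventually_elim
      case (elim u)
      then have "1 - x / u < 1" "1 - 1 / u < 1" using x by auto
      from one[OF this(1)] one[OF this(2)] show ?case by (simp only: div_by_1)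
    qed
    then have "((\<lambda>u. tail (cdf (distr M borel (\<lambda>_. 1))) (1 - x / u) /
        tail (cdf (distr M borel (\<lambda>_. 1))) (1 - 1 / u)) \<longlongrightarrow> 1) at_top"
      by (rule Lim_transform_eventually[OF tendsto_const])
    then show "((\<lambda>u. tail (cdf (distr M borel (\<lambda>_. 1))) (1 - x / u) /
        tail (cdf (distr M borel (\<lambda>_. 1))) (1 - 1 / u)) \<longlongrightarrow> x powr 0) at_top"
      using x by simp
  qed
  moreover have "((\<lambda>u. tail (cdf (distr M borel (\<lambda>_. 1 :: real))) u) \<longlongrightarrow> 1) (at_left 1)"
    by (rule Lim_transform_eventually[OF tendsto_const[of 1]]) (use one' in \<open>auto elim!: eventually_mono\<close>)
  ultimately show ?case by simp
next
  case (insert j I)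
  define T where "T = (\<lambda>\<omega>. \<Prod>i\<in>I. S i \<omega>)"
  define D :: "('a \<Rightarrow> real) \<Rightarrow> real measure" where "D = distr M borel"
  define a where "a = (\<Sum>i\<in>I. \<alpha> i)"
  have a: "0 \<le> a" using insert.prems(3) by (auto simp: a_def intro!: sum_nonneg)
  have \<alpha>j: "0 \<le> \<alpha> j" using insert.prems by auto
  have IH: "tail_regularly_varying_at_1 (cdf (D T)) a"
    "((\<lambda>u. tail (cdf (D T)) u /
      ((\<Prod>i\<in>I. Gamma (\<alpha> i + 1) * tail (cdf (D (S i))) u) / Gamma (a + 1))) \<longlongrightarrow> 1) (at_left 1)"
    using insert.IH[OF indep_vars_subset[OF insert.prems(1)]] insert.prems(2,3,4)
    by (auto simp: T_def D_def a_def)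
  have rvj: "tail_regularly_varying_at_1 (cdf (D (S j))) (\<alpha> j)"
    using insert.prems by (simp add: D_def)
  have indep: "indep_var borel (S j) borel T"
    unfolding T_def using insert.hyps insert.prems(1) by (intro indep_vars_prod)
  then have [measurable]: "random_variable borel (S j)" "random_variable borel T"
    by (auto dest: indep_var_rv1 indep_var_rv2)
  interpret T: real_distribution "D T"
    unfolding D_def by (rule real_distribution_distr) measurable
  interpret Sj: real_distribution "D (S j)"
    unfolding D_def by (rule real_distribution_distr) measurable
  have T1: "tail (cdf (D T)) 1 = 0"
  proof -
    have "T \<omega> \<le> 1" if "\<omega> \<in> space M" for \<omega>
      unfolding T_def using insert.prems(2)[OF _ that] by (intro prod_le_1) (auto simp: less_imp_le)
    then have "T -` {1<..} \<inter> space M = {}" by force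
    then show ?thesis
      unfolding T.tail_cdf unfolding D_def by (subst measure_distr) auto
  qed
  have supp: "AE t in D (S j). t \<in> {0<..<1}"
    unfolding D_def by (subst AE_distr_iff) (use insert.prems(2) in auto)
  have law: "D (\<lambda>\<omega>. \<Prod>i\<in>insert j I. S i \<omega>) = product_law (D T) (D (S j))"
  proof -
    have "D (\<lambda>\<omega>. S j \<omega> * T \<omega>) = product_law (D (S j)) (D T)"
      unfolding D_def by (rule distr_mult_eq_product_law[OF indep])
    also have "\<dots> = product_law (D T) (D (S j))"
      by (intro product_law_commute Sj.real_distribution_axioms T.real_distribution_axioms)
    finally show ?thesis
      using insert.hyps by (simp add: T_def)
  qed
  define K where "K = product_law (D T) (D (S j))"
  define c where "c = Gamma (a + 1) * Gamma (\<alpha> j + 1) / Gamma (a + \<alpha> j + 1)"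
  have Gamma_pos: "0 < Gamma (a + 1)" "0 < Gamma (\<alpha> j + 1)" "0 < Gamma (a + \<alpha> j + 1)"
    using a \<alpha>j by (auto intro!: Gamma_real_pos)
  have tail_K: "tail (cdf K) u = (\<integral>t. tail (cdf (D T)) (u / t) \<partial>D (S j))" for u
    unfolding K_def using supp
    by (intro tail_product_law T.real_distribution_axioms Sj.real_distribution_axioms) (auto elim!: eventually_mono)
  have lim: "((\<lambda>u. tail (cdf K) u / (tail (cdf (D T)) u * tail (cdf (D (S j))) u)) \<longlongrightarrow> c) (at_left 1)"
    unfolding tail_K c_def
    by (rule T.product_tail_regularly_varying[OF IH(1) a T1 Sj.real_distribution_axioms supp rvj \<alpha>j])
  have c: "0 < c" using Gamma_pos by (simp add: c_def)
  have "tail_regularly_varying_at_1 (cdf K) (a + \<alpha> j)"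
    by (rule tail_regularly_varying_at_1_asymp[OF lim _ IH(1) T.tail_nonneg rvj Sj.tail_nonneg]) (use c in simp)
  moreover have "((\<lambda>u. tail (cdf K) u / ((\<Prod>i\<in>insert j I. Gamma (\<alpha> i + 1) * tail (cdf (D (S i))) u) /
      Gamma (a + \<alpha> j + 1))) \<longlongrightarrow> 1) (at_left 1)"
  proof (rule Lim_transform_eventually)
    show "((\<lambda>u. tail (cdf K) u / (tail (cdf (D T)) u * tail (cdf (D (S j))) u) / c *
        (tail (cdf (D T)) u / ((\<Prod>i\<in>I. Gamma (\<alpha> i + 1) * tail (cdf (D (S i))) u) / Gamma (a + 1))))
        \<longlongrightarrow> 1) (at_left 1)"
      using tendsto_mult[OF tendsto_divide[OF lim tendsto_const[of c]] IH(2)] c by simp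
    show "\<forall>\<^sub>F u in at_left 1. tail (cdf K) u / (tail (cdf (D T)) u * tail (cdf (D (S j))) u) / c *
        (tail (cdf (D T)) u / ((\<Prod>i\<in>I. Gamma (\<alpha> i + 1) * tail (cdf (D (S i))) u) / Gamma (a + 1)))
        = tail (cdf K) u / ((\<Prod>i\<in>insert j I. Gamma (\<alpha> i + 1) * tail (cdf (D (S i))) u) / Gamma (a + \<alpha> j + 1))"
      using tail_regularly_varying_at_1_pos_at_left[OF IH(1) T.tail_nonneg]
    proof eventually_elim
      case (elim u)
      then show ?case
        using insert.hyps Gamma_pos by (simp add: c_def)
    qed
  qed
  moreover have sum_eq: "(\<Sum>i\<in>insert j I. \<alpha> i) = a + \<alpha> j"
    using insert.hyps by (simp add: a_def)
  ultimately show ?case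
    unfolding D_def[symmetric] law K_def[symmetric] sum_eq by blast
qed

section \<open>Subexponentiality\<close>

text \<open>The product inherits the Gumbel limit relation with the same scale: in
  \<open>tail (cdf N) (1 - 1 / (u * w u)) * tail (cdf M) u\<close> the first factor does not change asymptotically under
  \<open>u \<mapsto> u + x / w u\<close>, because \<open>u * w u\<close> changes by a factor tending to \<open>1\<close>.\<close>

lemma (in gumbel_distribution) product_law_tail_ratio:
  assumes N: "real_distribution N" and supp: "AE t in N. t \<in> {0<..<1}"
    and rv: "tail_regularly_varying_at_1 (cdf N) \<alpha>" and \<alpha>: "0 \<le> \<alpha>"
  shows "((\<lambda>u. tail (cdf (product_law M N)) (u + x / w u) / tail (cdf (product_law M N)) u)
      \<longlongrightarrow> exp (- x)) (up_to r)"
    and "eventually (\<lambda>u. 0 < tail (cdf (product_law M N)) u) (up_to r)"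
proof -
  interpret N: real_distribution N by fact
  interpret K: real_distribution "product_law M N"
    by (intro real_distribution_product_law real_distribution_axioms N)
  let ?f = "tail (cdf M)"
  let ?k = "tail (cdf (product_law M N))"
  define s where "s u = u * w u" for u
  define g where "g u = tail (cdf N) (1 - 1 / s u)" for u
  define c where "c = Gamma (\<alpha> + 1)"
  define v where "v u = u + x / w u" for u
  have c: "0 < c" unfolding c_def using \<alpha> by (intro Gamma_real_pos) simp
  have s: "filterlim s at_top (up_to r)" unfolding s_def by (rule u_w_at_top)
  have v: "filterlim v (up_to r) (up_to r)" unfolding v_def by (rule filterlim_shift)
  have g_pos: "eventually (\<lambda>u. 0 < g u) (up_to r)"
    unfolding g_def
    using filterlim_iff[THEN iffD1, OF s, rule_format, OF tail_regularly_varying_at_1_pos[OF rv N.tail_nonneg]] .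
  have "AE t in N. 0 < t" using supp by eventually_elim simp
  then have k: "?k u = (\<integral>t. ?f (u / t) \<partial>N)" for u
    by (intro tail_product_law real_distribution_axioms N)
  have lim: "((\<lambda>u. ?k u / (c * g u * ?f u)) \<longlongrightarrow> 1) (up_to r)"
    unfolding k c_def g_def s_def by (rule product_tail_gumbel[OF N supp rv \<alpha>])
  have "eventually (\<lambda>u. 0 < ?k u / (c * g u * ?f u)) (up_to r)"
    using lim by (rule order_tendstoD) simp
  then show "eventually (\<lambda>u. 0 < ?k u) (up_to r)"
    by eventually_elim (use K.tail_nonneg in \<open>auto simp: less_le\<close>)
  have "((\<lambda>u. (1 + x / s u) * (w (v u) / w u)) \<longlongrightarrow> (1 + 0) * 1) (up_to r)"
    unfolding v_def
    by (intro tendsto_mult tendsto_add tendsto_const w_self_neglecting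
        real_tendsto_divide_at_top[OF tendsto_const s])
  then have "((\<lambda>u. inverse ((1 + x / s u) * (w (v u) / w u))) \<longlongrightarrow> inverse 1) (up_to r)"
    by (intro tendsto_inverse) auto
  from N.tail_regularly_varying_at_1_moving[OF rv s this]
  have "((\<lambda>u. tail (cdf N) (1 - inverse ((1 + x / s u) * (w (v u) / w u)) / s u) / g u) \<longlongrightarrow> 1) (up_to r)"
    by (simp add: g_def)
  moreover have "eventually (\<lambda>u. tail (cdf N) (1 - inverse ((1 + x / s u) * (w (v u) / w u)) / s u) / g u
      = g (v u) / g u) (up_to r)"
    using ev_w_pos ev_pos
  proof eventually_elim
    case (elim u)
    have "v u = u * (1 + x / s u)"
      using elim by (simp add: v_def s_def field_simps)
    then have "s (v u) = s u * ((1 + x / s u) * (w (v u) / w u))"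
      using elim by (simp add: s_def)
    then have "inverse ((1 + x / s u) * (w (v u) / w u)) / s u = 1 / s (v u)"
      by (simp add: divide_inverse mult.commute)
    then show ?case by (simp add: g_def)
  qed
  ultimately have g_lim: "((\<lambda>u. g (v u) / g u) \<longlongrightarrow> 1) (up_to r)"
    by (rule Lim_transform_eventually)
  have "((\<lambda>u. (?k (v u) / (c * g (v u) * ?f (v u))) / (?k u / (c * g u * ?f u)) *
      (g (v u) / g u) * (?f (v u) / ?f u)) \<longlongrightarrow> 1 / 1 * 1 * exp (- x)) (up_to r)"
    by (intro tendsto_mult tendsto_divide lim g_lim filterlim_compose[OF lim v])
       (use tail_ratio in \<open>auto simp: v_def\<close>)
  moreover have "eventually (\<lambda>u. (?k (v u) / (c * g (v u) * ?f (v u))) / (?k u / (c * g u * ?f u)) *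
      (g (v u) / g u) * (?f (v u) / ?f u) = ?k (v u) / ?k u) (up_to r)"
    using g_pos ev_tail_pos
      filterlim_iff[THEN iffD1, OF v, rule_format, OF g_pos]
      filterlim_iff[THEN iffD1, OF v, rule_format, OF ev_tail_pos]
    by eventually_elim (use c in simp)
  ultimately have "((\<lambda>u. ?k (v u) / ?k u) \<longlongrightarrow> exp (- x)) (up_to r)"
    by (auto intro: Lim_transform_eventually)
  then show "((\<lambda>u. ?k (u + x / w u) / ?k u) \<longlongrightarrow> exp (- x)) (up_to r)"
    by (simp add: v_def)
qed

lemma (in real_distribution) measure_pair_eq_integral:
  assumes N: "real_distribution N" and [measurable]: "B \<in> sets borel"
  shows "measure (M \<Otimes>\<^sub>M N) {z. fst z \<in> B \<and> u < fst z + snd z} = (\<integral>x. indicator B x * tail (cdf N) (u - x) \<partial>M)"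
    and "measure (N \<Otimes>\<^sub>M M) {z. snd z \<in> B \<and> u < fst z + snd z} = (\<integral>x. indicator B x * tail (cdf N) (u - x) \<partial>M)"
proof -
  interpret N: real_distribution N by fact
  interpret MN: pair_prob_space M N ..
  interpret NM: pair_prob_space N M ..
  have int: "(\<integral>\<^sup>+x. ennreal (indicator B x * tail (cdf N) (u - x)) \<partial>M)
      = ennreal (\<integral>x. indicator B x * tail (cdf N) (u - x) \<partial>M)"
    by (rule nn_integral_eq_integral)
       (auto intro!: integrable_const_bound[where B = 1] simp: indicator_def N.tail_nonneg N.tail_le_1)
  have "{z \<in> space (borel \<Otimes>\<^sub>M borel). fst z \<in> B \<and> u < fst z + snd z} \<in> sets (borel \<Otimes>\<^sub>M borel)"
    by measurable
  then have [measurable]: "{z. fst z \<in> B \<and> u < fst z + snd z} \<in> sets (borel \<Otimes>\<^sub>M borel)"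
    by (simp add: space_pair_measure)
  have "{z \<in> space (borel \<Otimes>\<^sub>M borel). snd z \<in> B \<and> u < fst z + snd z} \<in> sets (borel \<Otimes>\<^sub>M borel)"
    by measurable
  then have [measurable]: "{z. snd z \<in> B \<and> u < fst z + snd z} \<in> sets (borel \<Otimes>\<^sub>M borel)"
    by (simp add: space_pair_measure)
  have 1: "emeasure N (Pair x -` {z. fst z \<in> B \<and> u < fst z + snd z}) = ennreal (indicator B x * tail (cdf N) (u - x))" for x
  proof -
    have "Pair x -` {z. fst z \<in> B \<and> u < fst z + snd z} = (if x \<in> B then {u - x<..} else {})"
      by (auto simp: field_simps)
    then show ?thesis by (simp add: N.tail_cdf N.emeasure_eq_measure)
  qed
  have 2: "emeasure N ((\<lambda>y. (y, x)) -` {z. snd z \<in> B \<and> u < fst z + snd z}) = ennreal (indicator B x * tail (cdf N) (u - x))" for x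
  proof -
    have "(\<lambda>y. (y, x)) -` {z. snd z \<in> B \<and> u < fst z + snd z} = (if x \<in> B then {u - x<..} else {})"
      by (auto simp: field_simps)
    then show ?thesis by (simp add: N.tail_cdf N.emeasure_eq_measure)
  qed
  have nonneg: "0 \<le> (\<integral>x. indicator B x * tail (cdf N) (u - x) \<partial>M)"
    by (intro integral_nonneg_AE) (auto simp: indicator_def N.tail_nonneg)
  have "emeasure (M \<Otimes>\<^sub>M N) {z. fst z \<in> B \<and> u < fst z + snd z}
      = (\<integral>\<^sup>+x. emeasure N (Pair x -` {z. fst z \<in> B \<and> u < fst z + snd z}) \<partial>M)"
    by (rule N.emeasure_pair_measure_alt) measurable
  then have "emeasure (M \<Otimes>\<^sub>M N) {z. fst z \<in> B \<and> u < fst z + snd z}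
      = ennreal (\<integral>x. indicator B x * tail (cdf N) (u - x) \<partial>M)"
    by (simp only: 1 int)
  then show "measure (M \<Otimes>\<^sub>M N) {z. fst z \<in> B \<and> u < fst z + snd z} = (\<integral>x. indicator B x * tail (cdf N) (u - x) \<partial>M)"
    using nonneg by (simp add: measure_def)
  have "emeasure (N \<Otimes>\<^sub>M M) {z. snd z \<in> B \<and> u < fst z + snd z}
      = (\<integral>\<^sup>+x. emeasure N ((\<lambda>y. (y, x)) -` {z. snd z \<in> B \<and> u < fst z + snd z}) \<partial>M)"
    by (rule NM.emeasure_pair_measure_alt2) measurable
  then have "emeasure (N \<Otimes>\<^sub>M M) {z. snd z \<in> B \<and> u < fst z + snd z}
      = ennreal (\<integral>x. indicator B x * tail (cdf N) (u - x) \<partial>M)"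
    by (simp only: 2 int)
  then show "measure (N \<Otimes>\<^sub>M M) {z. snd z \<in> B \<and> u < fst z + snd z} = (\<integral>x. indicator B x * tail (cdf N) (u - x) \<partial>M)"
    using nonneg by (simp add: measure_def)
qed

text \<open>If the sum of two copies exceeds \<open>u \<ge> 2 * a u\<close>, then either exactly one of them is at most \<open>a u\<close>, or both exceed
  \<open>a u\<close>.  Each of the two ways in which the first alternative can happen contributes \<open>1\<close> in the limit, by dominated
  convergence; the second is negligible by hypothesis.\<close>

lemma (in real_distribution) convolution_tail_limit:
  fixes a :: "real \<Rightarrow> real"
  assumes nonneg: "AE x in M. 0 \<le> x"
    and pos: "eventually (\<lambda>u. 0 < tail (cdf M) u) at_top"
    and long: "\<And>y. 0 \<le> y \<Longrightarrow> ((\<lambda>u. tail (cdf M) (u - y) / tail (cdf M) u) \<longlongrightarrow> 1) at_top"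
    and a: "filterlim a at_top at_top" "eventually (\<lambda>u. 2 * a u \<le> u) at_top"
    and bound: "eventually (\<lambda>u. tail (cdf M) (u - a u) \<le> B * tail (cdf M) u) at_top"
    and both: "((\<lambda>u. measure (M \<Otimes>\<^sub>M M) {z. a u < fst z \<and> a u < snd z \<and> u < fst z + snd z} / tail (cdf M) u) \<longlongrightarrow> 0) at_top"
  shows "((\<lambda>u. tail (cdf (M \<star> M)) u / tail (cdf M) u) \<longlongrightarrow> 2) at_top"
proof -
  let ?f = "tail (cdf M)"
  interpret MM: pair_prob_space M M ..
  interpret C: real_distribution "M \<star> M"
    unfolding convolution_def by (rule MM.real_distribution_distr) measurable
  define J1 where "J1 u = (\<integral>x. indicator {..a u} x * ?f (u - x) \<partial>M)" for u
  define J2 where "J2 u = measure (M \<Otimes>\<^sub>M M) {z. a u < fst z \<and> a u < snd z \<and> u < fst z + snd z}" for u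
  have sets: "{z. fst z \<le> (b::real) \<and> u < fst z + snd z} \<in> sets (M \<Otimes>\<^sub>M M)"
    "{z. snd z \<le> b \<and> u < fst z + snd z} \<in> sets (M \<Otimes>\<^sub>M M)"
    "{z. b < fst z \<and> b < snd z \<and> u < fst z + snd z} \<in> sets (M \<Otimes>\<^sub>M M)" for b u
  proof -
    have "{z \<in> space (M \<Otimes>\<^sub>M M). fst z \<le> (b::real) \<and> u < fst z + snd z} \<in> sets (M \<Otimes>\<^sub>M M)"
      "{z \<in> space (M \<Otimes>\<^sub>M M). snd z \<le> b \<and> u < fst z + snd z} \<in> sets (M \<Otimes>\<^sub>M M)"
      "{z \<in> space (M \<Otimes>\<^sub>M M). b < fst z \<and> b < snd z \<and> u < fst z + snd z} \<in> sets (M \<Otimes>\<^sub>M M)"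
      by measurable
    then show "{z. fst z \<le> (b::real) \<and> u < fst z + snd z} \<in> sets (M \<Otimes>\<^sub>M M)"
      "{z. snd z \<le> b \<and> u < fst z + snd z} \<in> sets (M \<Otimes>\<^sub>M M)"
      "{z. b < fst z \<and> b < snd z \<and> u < fst z + snd z} \<in> sets (M \<Otimes>\<^sub>M M)"
      by (simp_all add: space_pair_measure)
  qed
  have split: "tail (cdf (M \<star> M)) u = J1 u + J1 u + J2 u" if u: "2 * a u \<le> u" for u
  proof -
    let ?A = "{z. fst z \<le> a u \<and> u < fst z + snd z}" and ?B = "{z. snd z \<le> a u \<and> u < fst z + snd z}"
      and ?C = "{z. a u < fst z \<and> a u < snd z \<and> u < fst z + snd z}"
    have "tail (cdf (M \<star> M)) u = measure (M \<star> M) {u<..}" by (rule C.tail_cdf)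
    also have "\<dots> = measure (M \<Otimes>\<^sub>M M) ((\<lambda>(x, y). x + y) -` {u<..} \<inter> space (M \<Otimes>\<^sub>M M))"
      unfolding convolution_def by (rule measure_distr) measurable
    also have "(\<lambda>(x, y). x + y) -` {u<..} \<inter> space (M \<Otimes>\<^sub>M M) = (?A \<union> ?B) \<union> ?C"
      by (auto simp: space_pair_measure)
    also have "measure (M \<Otimes>\<^sub>M M) ((?A \<union> ?B) \<union> ?C) = measure (M \<Otimes>\<^sub>M M) (?A \<union> ?B) + measure (M \<Otimes>\<^sub>M M) ?C"
      using sets by (intro MM.finite_measure_Union) auto
    also have "measure (M \<Otimes>\<^sub>M M) (?A \<union> ?B) = measure (M \<Otimes>\<^sub>M M) ?A + measure (M \<Otimes>\<^sub>M M) ?B"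
      using sets u by (intro MM.finite_measure_Union) auto
    also have "measure (M \<Otimes>\<^sub>M M) ?A = J1 u"
      using measure_pair_eq_integral(1)[OF real_distribution_axioms, of "{..a u}" u] by (simp add: J1_def)
    also have "measure (M \<Otimes>\<^sub>M M) ?B = J1 u"
      using measure_pair_eq_integral(2)[OF real_distribution_axioms, of "{..a u}" u] by (simp add: J1_def)
    finally show ?thesis by (simp add: J2_def)
  qed
  have "((\<lambda>u. \<integral>x. indicator {..a u} x * ?f (u - x) / ?f u \<partial>M) \<longlongrightarrow> (\<integral>x. 1 \<partial>M)) at_top"
  proof (rule integral_dominated_convergence_at_top[where w = "\<lambda>_. B"])
    show "AE x in M. ((\<lambda>u. indicator {..a u} x * ?f (u - x) / ?f u) \<longlongrightarrow> 1) at_top"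
      using nonneg
    proof eventually_elim
      case (elim x)
      have "eventually (\<lambda>u. x \<le> a u) at_top" using a(1) by (simp add: filterlim_at_top)
      then show ?case
        by (intro Lim_transform_eventually[OF long[OF elim]]) (auto elim!: eventually_mono)
    qed
    show "\<forall>\<^sub>F u in at_top. AE x in M. norm (indicator {..a u} x * ?f (u - x) / ?f u) \<le> B"
      using bound pos
    proof eventually_elim
      case (elim u)
      have B: "0 \<le> B"
      proof -
        have "0 \<le> B * ?f u" using elim tail_nonneg[of "u - a u"] by linarith
        then show ?thesis using elim by (simp add: zero_le_mult_iff)
      qed
      show ?case
      proof (rule AE_I2)
        fix x
        show "norm (indicator {..a u} x * ?f (u - x) / ?f u) \<le> B"
        proof (cases "x \<le> a u")
          case True
          then have "?f (u - x) \<le> ?f (u - a u)" by (intro tail_antimono) simp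
          then have "?f (u - x) \<le> B * ?f u" using elim by linarith
          then show ?thesis using True elim tail_nonneg[of "u - x"] by (simp add: divide_le_eq)
        qed (use B in simp)
      qed
    qed
  qed (auto intro!: measurable_If)
  then have "((\<lambda>u. J1 u / ?f u) \<longlongrightarrow> 1) at_top"
    using prob_space by (simp add: J1_def)
  then have "((\<lambda>u. J1 u / ?f u + J1 u / ?f u + J2 u / ?f u) \<longlongrightarrow> 1 + 1 + 0) at_top"
    using both by (intro tendsto_add) (auto simp: J2_def)
  moreover have "eventually (\<lambda>u. J1 u / ?f u + J1 u / ?f u + J2 u / ?f u = tail (cdf (M \<star> M)) u / ?f u) at_top"
    using a(2) by eventually_elim (simp add: split add_divide_distrib)
  ultimately show ?thesis
    by (auto intro: Lim_transform_eventually)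
qed

lemma nn_integral_product_law:
  assumes "real_distribution P" "real_distribution Q" and [measurable]: "f \<in> borel_measurable borel"
  shows "(\<integral>\<^sup>+z. f z \<partial>product_law P Q) = (\<integral>\<^sup>+x. (\<integral>\<^sup>+t. f (x * t) \<partial>Q) \<partial>P)"
proof -
  interpret P: real_distribution P by fact
  interpret Q: real_distribution Q by fact
  interpret PQ: pair_prob_space P Q ..
  show ?thesis
    unfolding product_law_def by (simp add: nn_integral_distr Q.nn_integral_fst[symmetric])
qed

lemma emeasure_pair_eq_iterated:
  fixes a u :: real
  assumes "real_distribution P"
  shows "emeasure (P \<Otimes>\<^sub>M P) {z. a < fst z \<and> a < snd z \<and> u < fst z + snd z}
    = (\<integral>\<^sup>+x. (\<integral>\<^sup>+y. (if a < x \<and> a < y \<and> u < x + y then 1 else 0) \<partial>P) \<partial>P)"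
proof -
  interpret P: real_distribution P by fact
  interpret PP: pair_prob_space P P ..
  have [measurable]: "{z. a < fst z \<and> a < snd z \<and> u < fst z + snd z} \<in> sets (P \<Otimes>\<^sub>M P)"
  proof -
    have "{z \<in> space (P \<Otimes>\<^sub>M P). a < fst z \<and> a < snd z \<and> u < fst z + snd z} \<in> sets (P \<Otimes>\<^sub>M P)"
      by measurable
    then show ?thesis by (simp add: space_pair_measure)
  qed
  have "emeasure (P \<Otimes>\<^sub>M P) {z. a < fst z \<and> a < snd z \<and> u < fst z + snd z}
    = (\<integral>\<^sup>+z. indicator {z. a < fst z \<and> a < snd z \<and> u < fst z + snd z} z \<partial>(P \<Otimes>\<^sub>M P))"
    by (rule nn_integral_indicator[symmetric]) measurable
  also have "\<dots> = (\<integral>\<^sup>+z. (if a < fst z \<and> a < snd z \<and> u < fst z + snd z then 1 else 0) \<partial>(P \<Otimes>\<^sub>M P))"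
    by (intro nn_integral_cong) (auto simp: indicator_def)
  also have "\<dots> = (\<integral>\<^sup>+x. (\<integral>\<^sup>+y. (if a < x \<and> a < y \<and> u < x + y then 1 else 0) \<partial>P) \<partial>P)"
    by (subst P.nn_integral_fst[symmetric]) auto
  finally show ?thesis .
qed

text \<open>If \<open>x t + x' t' > u\<close> with \<open>x, x' > 0\<close> and \<open>t, t'\<close> in \<open>(0, 1)\<close>, then \<open>(x + x') max t t' > u\<close>, so up to a factor
  \<open>2\<close> only one of \<open>t, t'\<close> has to be kept.  Conditioning on it reduces the event for the product law to
  the same event for \<open>P\<close> at the level \<open>v = u / t \<ge> u\<close>; integrating the bound over \<open>t\<close> gives back the tail of
  the product.  Thus smallness relative to the tail of \<open>P\<close> passes to the product, although the tail of
  the product may be of smaller order.\<close>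

lemma both_large_product_law:
  assumes P: "real_distribution P" and Q: "real_distribution Q" and supp: "AE t in Q. t \<in> {0<..<1}"
    and a: "0 < a" and u: "0 < u" and e: "0 \<le> e"
    and bound: "\<And>v. u \<le> v \<Longrightarrow>
      measure (P \<Otimes>\<^sub>M P) {z. a < fst z \<and> a < snd z \<and> v < fst z + snd z} \<le> e * tail (cdf P) v"
  shows "measure (product_law P Q \<Otimes>\<^sub>M product_law P Q) {z. a < fst z \<and> a < snd z \<and> u < fst z + snd z}
    \<le> 2 * e * tail (cdf (product_law P Q)) u"
proof -
  interpret P: real_distribution P by fact
  interpret Q: real_distribution Q by fact
  interpret PQ: pair_sigma_finite P Q ..
  interpret PP: pair_prob_space P P ..
  define K where "K = product_law P Q"
  have K: "real_distribution K" unfolding K_def by (intro real_distribution_product_law P Q)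
  interpret K: real_distribution K by fact
  interpret KK: pair_prob_space K K ..
  define h where "h x x' t = (if a < x \<and> a < x' \<and> u < (x + x') * t then 1 else 0 :: ennreal)" for x x' t :: real
  define I where "I = (\<integral>\<^sup>+t. (\<integral>\<^sup>+x. (\<integral>\<^sup>+x'. h x x' t \<partial>P) \<partial>P) \<partial>Q)"
  have "emeasure (K \<Otimes>\<^sub>M K) {z. a < fst z \<and> a < snd z \<and> u < fst z + snd z}
    = (\<integral>\<^sup>+k. (\<integral>\<^sup>+k'. (if a < k \<and> a < k' \<and> u < k + k' then 1 else 0) \<partial>K) \<partial>K)"
    by (rule emeasure_pair_eq_iterated[OF K])
  also have "\<dots> = (\<integral>\<^sup>+x. (\<integral>\<^sup>+t. (\<integral>\<^sup>+k'. (if a < x * t \<and> a < k' \<and> u < x * t + k' then 1 else 0) \<partial>K) \<partial>Q) \<partial>P)"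
    unfolding K_def[of] by (subst nn_integral_product_law[OF P Q]) (auto simp: K_def[symmetric])
  also have "\<dots> = (\<integral>\<^sup>+x. (\<integral>\<^sup>+t. (\<integral>\<^sup>+x'. (\<integral>\<^sup>+t'.
      (if a < x * t \<and> a < x' * t' \<and> u < x * t + x' * t' then 1 else 0) \<partial>Q) \<partial>P) \<partial>Q) \<partial>P)"
    unfolding K_def by (subst nn_integral_product_law[OF P Q]) auto
  also have "\<dots> \<le> (\<integral>\<^sup>+x. (\<integral>\<^sup>+t. (\<integral>\<^sup>+x'. (\<integral>\<^sup>+t'. h x x' t + h x x' t' \<partial>Q) \<partial>P) \<partial>Q) \<partial>P)"
  proof (rule nn_integral_mono, rule nn_integral_mono_AE, use supp in eventually_elim,
      rule nn_integral_mono, rule nn_integral_mono_AE, use supp in eventually_elim)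
    fix x t x' t' :: real assume t: "t \<in> {0<..<1}" "t' \<in> {0<..<1}"
    have large: "a < y" if "a < y * b" "b \<in> {0<..<1}" for y b :: real
    proof -
      have "0 < y * b" using that(1) a by linarith
      then have "0 < y" using that(2) by (simp add: zero_less_mult_iff)
      then have "y * b < y * 1" using that(2) by (intro mult_strict_left_mono) auto
      then show ?thesis using that(1) by simp
    qed
    have "h x x' t = 1 \<or> h x x' t' = 1" if c: "a < x * t" "a < x' * t'" "u < x * t + x' * t'"
    proof (cases "t \<le> t'")
      case True
      have x: "a < x" "a < x'" using large c t by blast+
      then have "x * t \<le> x * t'" using True a by (intro mult_left_mono) auto
      with c have "u < (x + x') * t'" by (simp add: distrib_right)
      with x show ?thesis by (simp add: h_def)
    next
      case False
      have x: "a < x" "a < x'" using large c t by blast+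
      then have "x' * t' \<le> x' * t" using False a by (intro mult_left_mono) auto
      with c have "u < (x + x') * t" by (simp add: distrib_right)
      with x show ?thesis by (simp add: h_def)
    qed
    then show "(if a < x * t \<and> a < x' * t' \<and> u < x * t + x' * t' then 1 else 0) \<le> h x x' t + h x x' t'"
      by (auto simp: add_increasing add_increasing2)
  qed
  also have "\<dots> = (\<integral>\<^sup>+x. (\<integral>\<^sup>+t. (\<integral>\<^sup>+x'. h x x' t \<partial>P) \<partial>Q) \<partial>P) + (\<integral>\<^sup>+x. (\<integral>\<^sup>+x'. (\<integral>\<^sup>+t'. h x x' t' \<partial>Q) \<partial>P) \<partial>P)"
  proof -
    have "emeasure Q UNIV = 1" using Q.emeasure_space_1 by simp
    then show ?thesis unfolding h_def by (simp add: nn_integral_add)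
  qed
  also have "(\<integral>\<^sup>+x. (\<integral>\<^sup>+x'. (\<integral>\<^sup>+t'. h x x' t' \<partial>Q) \<partial>P) \<partial>P) = (\<integral>\<^sup>+x. (\<integral>\<^sup>+t. (\<integral>\<^sup>+x'. h x x' t \<partial>P) \<partial>Q) \<partial>P)"
    unfolding h_def by (intro nn_integral_cong PQ.Fubini'[symmetric]) measurable
  also have "(\<integral>\<^sup>+x. (\<integral>\<^sup>+t. (\<integral>\<^sup>+x'. h x x' t \<partial>P) \<partial>Q) \<partial>P) = I"
    unfolding h_def I_def by (intro PQ.Fubini'[symmetric]) measurable
  finally have 1: "emeasure (K \<Otimes>\<^sub>M K) {z. a < fst z \<and> a < snd z \<and> u < fst z + snd z} \<le> I + I" .
  have "I \<le> (\<integral>\<^sup>+t. ennreal (e * tail (cdf P) (u / t)) \<partial>Q)"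
    unfolding I_def
  proof (rule nn_integral_mono_AE, use supp in eventually_elim)
    case (elim t)
    have v: "u \<le> u / t" using elim u by (simp add: field_simps)
    have "(\<integral>\<^sup>+x. (\<integral>\<^sup>+x'. h x x' t \<partial>P) \<partial>P)
        = (\<integral>\<^sup>+x. (\<integral>\<^sup>+y. (if a < x \<and> a < y \<and> u / t < x + y then 1 else 0) \<partial>P) \<partial>P)"
      using elim by (simp add: h_def field_simps cong: conj_cong)
    also have "\<dots> = emeasure (P \<Otimes>\<^sub>M P) {z. a < fst z \<and> a < snd z \<and> u / t < fst z + snd z}"
      by (rule emeasure_pair_eq_iterated[OF P, symmetric])
    also have "\<dots> \<le> ennreal (e * tail (cdf P) (u / t))"
      unfolding PP.emeasure_eq_measure by (intro ennreal_leI bound v)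
    finally show ?case .
  qed
  also have "\<dots> = ennreal (\<integral>t. e * tail (cdf P) (u / t) \<partial>Q)"
  proof (rule nn_integral_eq_integral)
    show "integrable Q (\<lambda>t. e * tail (cdf P) (u / t))"
      by (intro integrable_mult_right Q.integrable_const_bound[where B = 1])
         (auto simp: P.tail_nonneg P.tail_le_1)
  qed (use e P.tail_nonneg in simp)
  also have "(\<integral>t. e * tail (cdf P) (u / t) \<partial>Q) = e * tail (cdf K) u"
  proof -
    have "AE t in Q. 0 < t" using supp by eventually_elim simp
    then show ?thesis unfolding K_def by (simp add: tail_product_law[OF P Q])
  qed
  finally have I: "I \<le> ennreal (e * tail (cdf K) u)" .
  have "emeasure (K \<Otimes>\<^sub>M K) {z. a < fst z \<and> a < snd z \<and> u < fst z + snd z}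
      \<le> ennreal (e * tail (cdf K) u) + ennreal (e * tail (cdf K) u)"
    using order_trans[OF 1 add_mono[OF I I]] .
  also have "\<dots> = ennreal (2 * e * tail (cdf K) u)"
    using e K.tail_nonneg[of u] by (simp add: ennreal_plus[symmetric] del: ennreal_plus)
  finally show ?thesis
    using e K.tail_nonneg[of u] unfolding KK.emeasure_eq_measure K_def[symmetric]
    by (subst (asm) ennreal_le_iff) auto
qed

lemma (in real_distribution) measure_pair_Times:
  assumes "A \<in> sets borel" "B \<in> sets borel"
  shows "measure (M \<Otimes>\<^sub>M M) (A \<times> B) = measure M A * measure M B"
proof -
  interpret MM: pair_prob_space M M ..
  have "emeasure (M \<Otimes>\<^sub>M M) (A \<times> B) = emeasure M A * emeasure M B"
    using assms by (intro emeasure_pair_measure_Times) auto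
  then show ?thesis
    by (simp add: emeasure_eq_measure MM.emeasure_eq_measure ennreal_mult[symmetric])
qed

text \<open>The integral hypothesis bounds the probability that both summands exceed \<open>l / w v\<close> and their sum
  exceeds \<open>v\<close>, whereas for the product one needs the threshold \<open>l / w u\<close>, uniformly in \<open>v \<ge> u\<close>.  The scale
  \<open>1 / w\<close> need not be monotone, but lowering the threshold from \<open>l / w v\<close> to \<open>l / w u\<close> is harmless: a
  summand between them forces the other one beyond \<open>v - l / w v\<close>, where the tail is comparable with the tail at
  \<open>v\<close>, and being beyond \<open>l / w u\<close> is itself improbable.\<close>

lemma (in gumbel_distribution) both_large_uniform:
  assumes r: "r = \<infinity>" and w0: "(w \<longlongrightarrow> 0) at_top" and l: "0 < l"
    and goldie: "((\<lambda>u. 1 / tail (cdf M) u *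
      (LINT y:{l / w u<..u - l / w u}|M. tail (cdf M) (u - y))) \<longlongrightarrow> 0) at_top"
    and e: "0 < e"
  shows "eventually (\<lambda>u. \<forall>v\<ge>u. measure (M \<Otimes>\<^sub>M M)
    {z. l / w u < fst z \<and> l / w u < snd z \<and> v < fst z + snd z} \<le> e * tail (cdf M) v) at_top"
proof -
  interpret MM: pair_prob_space M M ..
  let ?f = "tail (cdf M)"
  have up: "up_to r = at_top" using r by (simp add: up_to_def)
  define a where "a u = l / w u" for u
  define I where "I v = (\<integral>x. indicator {a v<..v - a v} x * ?f (v - x) \<partial>M)" for v
  define B where "B = exp l + 1"
  \<comment> \<open>One portion of \<open>e\<close> goes to the integral, and \<open>B\<close> portions to each of three rectangles.\<close>
  define d where "d = e / (1 + 3 * B)"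
  have B: "0 < B" by (simp add: B_def add_pos_pos)
  have d: "0 < d" using e B by (simp add: d_def)
  have a_top: "filterlim a at_top at_top"
  proof -
    have "filterlim (\<lambda>u. inverse (w u)) at_top at_top"
      by (rule filterlim_inverse_at_top[OF w0]) (use ev_w_pos up in simp)
    then show ?thesis
      unfolding a_def divide_inverse by (rule filterlim_tendsto_pos_mult_at_top[OF tendsto_const l])
  qed
  have f0: "(?f \<longlongrightarrow> 0) at_top"
    using tendsto_diff[OF tendsto_const[of 1] cdf_lim_at_top_prob] by (simp add: tail_def[abs_def])
  have a_small: "eventually (\<lambda>u. ?f (a u) \<le> d) at_top"
    using order_tendstoD(2)[OF filterlim_compose[OF f0 a_top] d] by eventually_elim simp
  have ratio: "eventually (\<lambda>v. ?f (v - a v) \<le> B * ?f v) at_top"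
  proof -
    have "((\<lambda>v. ?f (v + (- l) / w v) / ?f v) \<longlongrightarrow> exp l) at_top"
      using tail_ratio[of "- l"] unfolding up by simp
    then have "eventually (\<lambda>v. ?f (v + (- l) / w v) / ?f v < B) at_top"
      by (rule order_tendstoD) (simp add: B_def)
    then show ?thesis
      using ev_tail_pos unfolding up by eventually_elim (simp add: a_def divide_less_eq)
  qed
  have I_small: "eventually (\<lambda>v. I v \<le> d * ?f v) at_top"
    using order_tendstoD(2)[OF goldie d] ev_tail_pos unfolding up
    by eventually_elim (simp add: I_def a_def set_lebesgue_integral_def divide_less_eq)
  have "eventually (\<lambda>v. ?f (a v) \<le> d \<and> ?f (v - a v) \<le> B * ?f v \<and> I v \<le> d * ?f v) at_top"
    using a_small ratio I_small by eventually_elim simp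
  then obtain u0 where u0: "\<And>v. v \<ge> u0 \<Longrightarrow> ?f (a v) \<le> d \<and> ?f (v - a v) \<le> B * ?f v \<and> I v \<le> d * ?f v"
    unfolding eventually_at_top_linorder by blast
  have "measure (M \<Otimes>\<^sub>M M) {z. a u < fst z \<and> a u < snd z \<and> v < fst z + snd z} \<le> e * ?f v"
    if "u0 \<le> u" "u \<le> v" for u v
  proof -
    \<comment> \<open>\<open>?A\<close> is measured by the integral; \<open>?B1\<close> collects the remaining points with both coordinates
      above \<open>a v\<close>; \<open>?B2\<close> and \<open>?B3\<close> those with one coordinate at most \<open>a v\<close>.\<close>
    let ?A = "{z. fst z \<in> {a v<..v - a v} \<and> v < fst z + snd z}"
    let ?m = "measure (M \<Otimes>\<^sub>M M)"
    have A: "?A \<in> sets (M \<Otimes>\<^sub>M M)"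
    proof -
      have "{z \<in> space (M \<Otimes>\<^sub>M M). fst z \<in> {a v<..v - a v} \<and> v < fst z + snd z} \<in> sets (M \<Otimes>\<^sub>M M)"
        by measurable
      then show ?thesis by (simp add: space_pair_measure)
    qed
    have Times: "S \<times> T \<in> sets (M \<Otimes>\<^sub>M M)" if "S \<in> sets borel" "T \<in> sets borel" for S T
      using that by (intro pair_measureI) auto
    let ?B1 = "{v - a v<..} \<times> {a v<..}" and ?B2 = "{a u<..} \<times> {v - a v<..}"
      and ?B3 = "{v - a v<..} \<times> {a u<..}"
    have B: "?B1 \<in> sets (M \<Otimes>\<^sub>M M)" "?B2 \<in> sets (M \<Otimes>\<^sub>M M)" "?B3 \<in> sets (M \<Otimes>\<^sub>M M)"
      by (rule Times; simp)+
    have "{z. a u < fst z \<and> a u < snd z \<and> v < fst z + snd z} \<subseteq> ?A \<union> (?B1 \<union> (?B2 \<union> ?B3))"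
      by auto
    then have "?m {z. a u < fst z \<and> a u < snd z \<and> v < fst z + snd z} \<le> ?m (?A \<union> (?B1 \<union> (?B2 \<union> ?B3)))"
      by (rule MM.finite_measure_mono) (intro sets.Un A B)
    also have "\<dots> \<le> ?m ?A + (?m ?B1 + (?m ?B2 + ?m ?B3))"
    proof -
      have "?m (?A \<union> (?B1 \<union> (?B2 \<union> ?B3))) \<le> ?m ?A + ?m (?B1 \<union> (?B2 \<union> ?B3))"
        by (intro measure_Un_le sets.Un A B)
      moreover have "?m (?B1 \<union> (?B2 \<union> ?B3)) \<le> ?m ?B1 + ?m (?B2 \<union> ?B3)"
        by (intro measure_Un_le sets.Un B)
      moreover have "?m (?B2 \<union> ?B3) \<le> ?m ?B2 + ?m ?B3"
        by (intro measure_Un_le B)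
      ultimately show ?thesis by linarith
    qed
    also have "?m ?A = I v"
      unfolding I_def by (rule measure_pair_eq_integral(1)[OF real_distribution_axioms]) simp
    also have "?m ({v - a v<..} \<times> {a v<..}) = ?f (v - a v) * ?f (a v)"
      by (simp add: measure_pair_Times tail_cdf)
    also have "?m ({a u<..} \<times> {v - a v<..}) = ?f (v - a v) * ?f (a u)"
      by (simp add: measure_pair_Times tail_cdf)
    also have "?m ({v - a v<..} \<times> {a u<..}) = ?f (v - a v) * ?f (a u)"
      by (simp add: measure_pair_Times tail_cdf)
    also have "I v + (?f (v - a v) * ?f (a v) + (?f (v - a v) * ?f (a u) + ?f (v - a v) * ?f (a u)))
        \<le> d * ?f v + ((B * ?f v) * d + ((B * ?f v) * d + (B * ?f v) * d))"
      using u0[of v] u0[of u] that \<open>0 < B\<close> tail_nonneg by (intro add_mono mult_mono) auto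
    also have "\<dots> = (d * (1 + 3 * B)) * ?f v" by (simp add: algebra_simps)
    also have "d * (1 + 3 * B) = e" using \<open>0 < B\<close> by (simp add: d_def)
    finally show ?thesis .
  qed
  then show ?thesis
    unfolding eventually_at_top_linorder a_def by blast
qed

text \<open>With \<open>a u = l / w u\<close> the hypotheses of the convolution criterion hold: the product is long-tailed
  because \<open>1 / w\<close> tends to infinity, its tail at \<open>u - a u\<close> is about \<open>exp l\<close> times the one at \<open>u\<close>, and two
  large summands are negligible by the comparison with the first factor.\<close>

lemma (in gumbel_distribution) product_law_subexponential:
  assumes N: "real_distribution N" and supp: "AE t in N. t \<in> {0<..<1}"
    and rv: "tail_regularly_varying_at_1 (cdf N) \<alpha>" and \<alpha>: "0 \<le> \<alpha>"
    and nonneg: "AE x in M. 0 \<le> x"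
    and r: "r = \<infinity>" and w0: "(w \<longlongrightarrow> 0) at_top" and l: "0 < l"
    and goldie: "((\<lambda>u. 1 / tail (cdf M) u *
      (LINT y:{l / w u<..u - l / w u}|M. tail (cdf M) (u - y))) \<longlongrightarrow> 0) at_top"
  shows "cdf (product_law M N) \<in> \<S>\<^sub>+"
proof -
  interpret N: real_distribution N by fact
  define K where "K = product_law M N"
  have K: "real_distribution K"
    unfolding K_def by (intro real_distribution_product_law real_distribution_axioms N)
  interpret K: real_distribution K by fact
  interpret MN: pair_prob_space M N ..
  let ?k = "tail (cdf K)"
  have up: "up_to r = at_top" using r by (simp add: up_to_def)
  define a where "a u = l / w u" for u
  have w_pos': "0 < w u" for u using w_pos r by simp
  have ratio: "((\<lambda>u. ?k (u + x / w u) / ?k u) \<longlongrightarrow> exp (- x)) at_top" for x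
    using product_law_tail_ratio(1)[OF N supp rv \<alpha>, of x] unfolding up K_def .
  have k_pos: "eventually (\<lambda>u. 0 < ?k u) at_top"
    using product_law_tail_ratio(2)[OF N supp rv \<alpha>] unfolding up K_def .
  have K_nonneg: "AE x in K. 0 \<le> x"
  proof -
    have "AE z in M \<Otimes>\<^sub>M N. 0 \<le> fst z * snd z"
    proof (rule MN.AE_pair_measure)
      show "AE x in M. AE y in N. 0 \<le> fst (x, y) * snd (x, y)"
        using nonneg
      proof eventually_elim
        case (elim x)
        show ?case using supp by eventually_elim (use elim in simp)
      qed
    qed measurable
    then show ?thesis
      unfolding K_def product_law_def by (subst AE_distr_iff) (auto simp: case_prod_beta')
  qed
  have uw: "filterlim (\<lambda>u. u * w u) at_top at_top" using u_w_at_top unfolding up .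
  have a_top: "filterlim a at_top at_top"
  proof -
    have "filterlim (\<lambda>u. inverse (w u)) at_top at_top"
      by (rule filterlim_inverse_at_top[OF w0]) (simp add: w_pos')
    then show ?thesis
      unfolding a_def divide_inverse by (rule filterlim_tendsto_pos_mult_at_top[OF tendsto_const l])
  qed
  have a_half: "eventually (\<lambda>u. 2 * a u \<le> u) at_top"
  proof -
    have "eventually (\<lambda>u. 2 * l \<le> u * w u) at_top" using uw by (simp add: filterlim_at_top)
    then show ?thesis
      by eventually_elim (use w_pos' in \<open>simp add: a_def pos_divide_le_eq\<close>)
  qed
  have bound: "eventually (\<lambda>u. ?k (u - a u) \<le> (exp l + 1) * ?k u) at_top"
  proof -
    have "eventually (\<lambda>u. ?k (u + (- l) / w u) / ?k u < exp l + 1) at_top"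
      using ratio[of "- l"] by (rule order_tendstoD) simp
    then show ?thesis
      using k_pos by eventually_elim (simp add: a_def divide_less_eq)
  qed
  have long: "((\<lambda>u. ?k (u - y) / ?k u) \<longlongrightarrow> 1) at_top" if y: "0 \<le> y" for y
  proof (rule order_tendstoI)
    fix c :: real assume "c < 1"
    show "eventually (\<lambda>u. c < ?k (u - y) / ?k u) at_top"
      using k_pos
    proof eventually_elim
      case (elim u)
      have "?k u \<le> ?k (u - y)" using y by (intro K.tail_antimono) simp
      then have "1 \<le> ?k (u - y) / ?k u" using elim by simp
      with \<open>c < 1\<close> show ?case by linarith
    qed
  next
    fix c :: real assume c: "1 < c"
    define h where "h = ln c / 2"
    have h: "0 < h" "h < ln c" using c by (auto simp: h_def)
    have "exp h < exp (ln c)" using h(2) by (rule exp_less_mono)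
    then have "exp h < c" using c by (simp del: exp_less_cancel_iff)
    then have "eventually (\<lambda>u. ?k (u + (- h) / w u) / ?k u < c) at_top"
      using ratio[of "- h"] by (intro order_tendstoD) auto
    moreover have "eventually (\<lambda>u. y * w u < h) at_top"
      using tendsto_mult_right_zero[OF w0, of y] h by (intro order_tendstoD) auto
    ultimately show "eventually (\<lambda>u. ?k (u - y) / ?k u < c) at_top"
      using k_pos
    proof eventually_elim
      case (elim u)
      have "y \<le> h / w u" using elim w_pos'[of u] by (simp add: pos_le_divide_eq)
      then have "?k (u - y) \<le> ?k (u + (- h) / w u)" by (intro K.tail_antimono) simp
      then have "?k (u - y) / ?k u \<le> ?k (u + (- h) / w u) / ?k u"
        using elim by (intro divide_right_mono) auto
      with elim show ?case by linarith
    qed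
  qed
  have both: "((\<lambda>u. measure (K \<Otimes>\<^sub>M K) {z. a u < fst z \<and> a u < snd z \<and> u < fst z + snd z} / ?k u) \<longlongrightarrow> 0) at_top"
  proof (rule order_tendstoI)
    fix c :: real assume "c < 0"
    moreover have "0 \<le> measure (K \<Otimes>\<^sub>M K) {z. a u < fst z \<and> a u < snd z \<and> u < fst z + snd z} / ?k u" for u
      by (intro divide_nonneg_nonneg measure_nonneg K.tail_nonneg)
    ultimately show "eventually (\<lambda>u. c < measure (K \<Otimes>\<^sub>M K) {z. a u < fst z \<and> a u < snd z \<and> u < fst z + snd z} / ?k u) at_top"
      by (intro always_eventually allI) (rule less_le_trans)
  next
    fix c :: real assume c: "0 < c"
    have "eventually (\<lambda>u. \<forall>v\<ge>u. measure (M \<Otimes>\<^sub>M M)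
        {z. a u < fst z \<and> a u < snd z \<and> v < fst z + snd z} \<le> (c / 3) * tail (cdf M) v) at_top"
      unfolding a_def by (rule both_large_uniform[OF r w0 l goldie]) (use c in simp)
    then show "eventually (\<lambda>u. measure (K \<Otimes>\<^sub>M K) {z. a u < fst z \<and> a u < snd z \<and> u < fst z + snd z} / ?k u < c) at_top"
      using k_pos eventually_gt_at_top[of 0]
    proof eventually_elim
      case (elim u)
      have "measure (K \<Otimes>\<^sub>M K) {z. a u < fst z \<and> a u < snd z \<and> u < fst z + snd z} \<le> 2 * (c / 3) * ?k u"
        unfolding K_def using elim c l w_pos'[of u]
        by (intro both_large_product_law real_distribution_axioms N supp) (auto simp: a_def)
      also have "\<dots> < c * ?k u" using elim c by simp
      finally show ?case using elim by (simp add: divide_less_eq)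
    qed
  qed
  have "((\<lambda>u. tail (cdf (K \<star> K)) u / ?k u) \<longlongrightarrow> 2) at_top"
    by (rule K.convolution_tail_limit[OF K_nonneg k_pos long a_top a_half bound both])
  moreover have "(cdf K \<longlongrightarrow> 0) (at_left 0)"
  proof -
    have "measure K {..<0} = 0"
      using K_nonneg by (intro K.prob_eq_0[THEN iffD2]) (auto simp: not_less)
    then show ?thesis using K.cdf_at_left[of 0] by simp
  qed
  moreover have "upper_endpoint (cdf K) = \<infinity>"
  proof (rule ereal_top)
    fix B
    have "eventually (\<lambda>u. B \<le> u \<and> 0 < ?k u) at_top"
      using k_pos eventually_ge_at_top[of B] by eventually_elim simp
    then obtain u where u: "B \<le> u" "0 < ?k u"
      using eventually_happens'[of at_top] by force
    then have "ereal u \<le> upper_endpoint (cdf K)"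
      unfolding upper_endpoint_def by (intro SUP_upper) (simp add: tail_def)
    then show "ereal B \<le> upper_endpoint (cdf K)"
      using u by (meson ereal_less_eq(3) order_trans)
  qed
  ultimately show ?thesis
    unfolding subexponential_pos_def K_def[symmetric] using K by blast
qed

section \<open>The theorem\<close>

lemma interval_measure_cdf:
  assumes "real_distribution N"
  shows "interval_measure (cdf N) = N"
proof -
  interpret N: real_distribution N by fact
  show ?thesis
  proof (rule cdf_unique)
    show "real_distribution (interval_measure (cdf N))"
      by (rule real_distribution_interval_measure)
         (auto intro: N.cdf_nondecreasing N.cdf_is_right_cont N.cdf_lim_at_bot N.cdf_lim_at_top_prob)
    show "cdf (interval_measure (cdf N)) = cdf N"
      by (rule cdf_interval_measure) (auto intro: N.cdf_nondecreasing N.cdf_is_right_cont N.cdf_lim_at_bot)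
  qed fact
qed

lemma (in real_distribution) tail_at_upper_endpoint:
  assumes "upper_endpoint (cdf M) \<le> ereal b"
  shows "tail (cdf M) b = 0"
proof -
  have one: "cdf M x = 1" if "b < x" for x
    using assms that cdf_bounded_prob[of x] by (auto simp: upper_endpoint_le_iff intro: antisym)
  have "(cdf M \<longlongrightarrow> 1) (at_right b)"
    by (rule Lim_transform_eventually[OF tendsto_const])
       (auto simp: eventually_at_right[of b "b + 1"] one intro!: exI[of _ "b + 1"])
  moreover have "(cdf M \<longlongrightarrow> cdf M b) (at_right b)"
    using cdf_is_right_cont[of b] by (simp add: continuous_within)
  ultimately have "cdf M b = 1"
    using tendsto_unique trivial_limit_at_right_real by blast
  then show ?thesis by (simp add: tail_def)
qed

theorem theorem3p1:
  fixes M :: "'a measure" and n :: nat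
    and S :: "nat \<Rightarrow> 'a \<Rightarrow> real" and R X :: "'a \<Rightarrow> real"
    and G :: "nat \<Rightarrow> real \<Rightarrow> real" and F H :: "real \<Rightarrow> real"
    and \<alpha> :: "nat \<Rightarrow> real"
  assumes "prob_space M"
    and "1 \<le> n"
    and indep: "prob_space.indep_vars M (\<lambda>_. borel) (S(0 := R)) {0..n}"
    and S_range: "\<forall>i\<in>{1..n}. \<forall>\<omega>\<in>space M. S i \<omega> \<in> {0<..<1}"
    and G: "\<forall>i\<in>{1..n}. G i = cdf (distr M borel (S i))"
    and F: "F = cdf (distr M borel R)"
    and F0: "(F \<longlongrightarrow> 0) (at_left 0)"
    and rF: "0 < upper_endpoint F"
    and alpha: "\<forall>i\<in>{1..n}. 0 \<le> \<alpha> i \<and>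
      (\<forall>x>0. ((\<lambda>u. tail (G i) (1 - x / u) / tail (G i) (1 - 1 / u)) \<longlongrightarrow> x powr \<alpha> i) at_top)"
    and X: "X = (\<lambda>\<omega>. R \<omega> * (\<Prod>i=1..n. S i \<omega>))"
    and H: "H = cdf (distr M borel X)"
  shows "(\<forall>w. MDA_Gumbel F w \<longrightarrow>
      ((\<lambda>u. measure M {\<omega> \<in> space M. X \<omega> > u} /
            ((\<Prod>i=1..n. Gamma (\<alpha> i + 1) * tail (G i) (1 - 1 / (u * w u))) * tail F u))
          \<longlongrightarrow> 1) (up_to (upper_endpoint F)))
    \<and> (\<forall>w. MDA_Gumbel F w \<and> upper_endpoint F = \<infinity> \<and> (w \<longlongrightarrow> 0) at_top \<and>
        (\<exists>l>0. ((\<lambda>u. 1 / tail F u *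
            (LINT y:{l / w u<..u - l / w u}|interval_measure F. tail F (u - y)))
          \<longlongrightarrow> 0) at_top)
      \<longrightarrow> H \<in> \<S>\<^sub>+)
    \<and> (\<forall>\<gamma>\<ge>0. MDA_Weibull F \<gamma> \<and> upper_endpoint F = 1 \<longrightarrow>
      ((\<lambda>u. measure M {\<omega> \<in> space M. X \<omega> > u} /
            (Gamma (\<gamma> + 1) / Gamma (\<gamma> + (\<Sum>i=1..n. \<alpha> i) + 1) *
             (\<Prod>i=1..n. Gamma (\<alpha> i + 1) * tail (G i) u) * tail F u))
          \<longlongrightarrow> 1) (at_left 1))"
proof -
  interpret prob_space M by fact
  define T where "T = (\<lambda>\<omega>. \<Prod>i=1..n. S i \<omega>)"
  define P where "P = distr M borel R"
  define Q where "Q = distr M borel T"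
  define a where "a = (\<Sum>i=1..n. \<alpha> i)"
  define \<pi> where "\<pi> u = (\<Prod>i=1..n. Gamma (\<alpha> i + 1) * tail (G i) u)" for u
  have a: "0 \<le> a" unfolding a_def using alpha by (intro sum_nonneg) auto
  have indep_S: "indep_vars (\<lambda>_. borel) S {1..n}"
    using indep_vars_subset[OF indep, of "{1..n}"] by (subst indep_vars_cong[OF refl _ refl]) auto
  have "indep_vars (\<lambda>_. borel) (S(0 := R)) (insert 0 {1..n})"
    using indep by (rule back_subst[where P = "indep_vars _ _"]) auto
  then have "indep_var borel ((S(0 := R)) 0) borel (\<lambda>\<omega>. \<Prod>i\<in>{1..n}. (S(0 := R)) i \<omega>)"
    by (rule indep_vars_prod[rotated 2]) auto
  moreover have "(\<lambda>\<omega>. \<Prod>i\<in>{1..n}. (S(0 := R)) i \<omega>) = T"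
    unfolding T_def by (intro ext prod.cong) auto
  ultimately have RT: "indep_var borel R borel T" by simp
  then have [measurable]: "random_variable borel R" "random_variable borel T"
    by (auto dest: indep_var_rv1 indep_var_rv2)
  interpret P: real_distribution P unfolding P_def by (rule real_distribution_distr) measurable
  interpret Q: real_distribution Q unfolding Q_def by (rule real_distribution_distr) measurable
  have F_eq: "F = cdf P" by (simp add: F P_def)
  have X_eq: "X = (\<lambda>\<omega>. R \<omega> * T \<omega>)" by (simp add: X T_def)
  have [measurable]: "random_variable borel X" unfolding X_eq by measurable
  have law: "distr M borel X = product_law P Q"
    unfolding X_eq P_def Q_def by (rule distr_mult_eq_product_law[OF RT])
  interpret K: real_distribution "product_law P Q"
    by (intro real_distribution_product_law P.real_distribution_axioms Q.real_distribution_axioms)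
  have supp: "AE t in Q. t \<in> {0<..<1}"
    unfolding Q_def
  proof (subst AE_distr_iff)
    have "T \<omega> \<in> {0<..<1}" if \<omega>: "\<omega> \<in> space M" for \<omega>
    proof -
      have S: "0 < S i \<omega>" "S i \<omega> < 1" if "i \<in> {1..n}" for i
        using S_range that \<omega> by auto
      have "0 < T \<omega>" unfolding T_def using S by (intro prod_pos) auto
      moreover have "T \<omega> < (\<Prod>i=1..n. 1)"
        unfolding T_def using S \<open>1 \<le> n\<close> by (intro prod_mono_strict) (auto simp: less_imp_le)
      ultimately show ?thesis by simp
    qed
    then show "AE \<omega> in M. T \<omega> \<in> {0<..<1}" by simp
  qed auto
  then have pos: "AE t in Q. 0 < t" by eventually_elim simp
  have X_tail: "measure M {\<omega> \<in> space M. X \<omega> > u} = (\<integral>t. tail (cdf P) (u / t) \<partial>Q)" for u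
  proof -
    have "measure M {\<omega> \<in> space M. X \<omega> > u} = measure (distr M borel X) {u<..}"
      by (subst measure_distr) (auto intro!: arg_cong[where f = "measure M"])
    also have "\<dots> = tail (cdf (product_law P Q)) u" by (simp add: law K.tail_cdf)
    also have "\<dots> = (\<integral>t. tail (cdf P) (u / t) \<partial>Q)"
      by (rule tail_product_law[OF P.real_distribution_axioms Q.real_distribution_axioms pos])
    finally show ?thesis .
  qed
  have "tail_regularly_varying_at_1 (cdf Q) a \<and>
    ((\<lambda>u. tail (cdf Q) u / ((\<Prod>i\<in>{1..n}. Gamma (\<alpha> i + 1) * tail (cdf (distr M borel (S i))) u) / Gamma (a + 1)))
      \<longlongrightarrow> 1) (at_left 1)"
    unfolding Q_def T_def a_def
    by (rule tail_prod_regularly_varying[OF _ indep_S])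
       (use S_range alpha G in \<open>auto simp: tail_regularly_varying_at_1_def\<close>)
  moreover have "(\<Prod>i\<in>{1..n}. Gamma (\<alpha> i + 1) * tail (cdf (distr M borel (S i))) u) = \<pi> u" for u
    unfolding \<pi>_def using G by (intro prod.cong) auto
  ultimately have rv: "tail_regularly_varying_at_1 (cdf Q) a"
    and Q_lim: "((\<lambda>u. tail (cdf Q) u / (\<pi> u / Gamma (a + 1))) \<longlongrightarrow> 1) (at_left 1)"
    by auto
  have Q_pos: "eventually (\<lambda>u. 0 < tail (cdf Q) u) (at_left 1)"
    by (rule tail_regularly_varying_at_1_pos_at_left[OF rv Q.tail_nonneg])
  have Gamma_a: "0 < Gamma (a + 1)" using a by (intro Gamma_real_pos) simp

  have part_a: "((\<lambda>u. measure M {\<omega> \<in> space M. X \<omega> > u} / (\<pi> (1 - 1 / (u * w u)) * tail F u))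
      \<longlongrightarrow> 1) (up_to (upper_endpoint F))" if w: "MDA_Gumbel F w" for w
  proof -
    interpret gumbel_distribution P w
      by unfold_locales (use w in \<open>simp add: F_eq\<close>)
    define v where "v u = 1 - 1 / (u * w u)" for u
    have v: "filterlim v (at_left 1) (up_to r)"
      unfolding v_def using filterlim_compose[OF filterlim_one_minus_at_left[OF zero_less_one] u_w_at_top] .
    have "((\<lambda>u. (\<integral>t. tail (cdf P) (u / t) \<partial>Q) / (Gamma (a + 1) * tail (cdf Q) (v u) * tail (cdf P) u) *
        (tail (cdf Q) (v u) / (\<pi> (v u) / Gamma (a + 1)))) \<longlongrightarrow> 1 * 1) (up_to r)"
      unfolding v_def[symmetric]
      by (intro tendsto_mult filterlim_compose[OF Q_lim v])
         (use product_tail_gumbel[OF Q.real_distribution_axioms supp rv a] in \<open>simp add: v_def\<close>)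
    moreover have "eventually (\<lambda>u. (\<integral>t. tail (cdf P) (u / t) \<partial>Q) / (Gamma (a + 1) * tail (cdf Q) (v u) * tail (cdf P) u) *
        (tail (cdf Q) (v u) / (\<pi> (v u) / Gamma (a + 1)))
        = measure M {\<omega> \<in> space M. X \<omega> > u} / (\<pi> (v u) * tail F u)) (up_to r)"
      using filterlim_iff[THEN iffD1, OF v, rule_format, OF Q_pos]
      by eventually_elim (use Gamma_a in \<open>simp add: X_tail F_eq\<close>)
    ultimately show ?thesis
      unfolding v_def F_eq by (auto intro: Lim_transform_eventually)
  qed
  have part_a1: "H \<in> \<S>\<^sub>+"
    if w: "MDA_Gumbel F w" and r: "upper_endpoint F = \<infinity>" and w0: "(w \<longlongrightarrow> 0) at_top" and l: "0 < l"
      and goldie: "((\<lambda>u. 1 / tail F u *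
            (LINT y:{l / w u<..u - l / w u}|interval_measure F. tail F (u - y))) \<longlongrightarrow> 0) at_top" for w l
  proof -
    interpret gumbel_distribution P w
      by unfold_locales (use w in \<open>simp add: F_eq\<close>)
    have "measure P {..<0} = 0"
      using tendsto_unique[OF _ P.cdf_at_left[of 0]] F0 by (simp add: F_eq)
    then have "AE x in P. x \<notin> {..<0}"
      by (intro P.prob_eq_0[THEN iffD1]) auto
    then have nonneg: "AE x in P. 0 \<le> x"
      by eventually_elim simp
    show ?thesis
      unfolding H law
      by (rule product_law_subexponential[OF Q.real_distribution_axioms supp rv a nonneg _ w0 l])
         (use r goldie in \<open>simp_all add: F_eq interval_measure_cdf[OF P.real_distribution_axioms]\<close>)
  qed
  have part_b: "((\<lambda>u. measure M {\<omega> \<in> space M. X \<omega> > u} /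
        (Gamma (\<gamma> + 1) / Gamma (\<gamma> + a + 1) * \<pi> u * tail F u)) \<longlongrightarrow> 1) (at_left 1)"
    if \<gamma>: "0 \<le> \<gamma>" and W: "MDA_Weibull F \<gamma>" and r: "upper_endpoint F = 1" for \<gamma>
  proof -
    have rvP: "tail_regularly_varying_at_1 (cdf P) \<gamma>"
      using W r by (simp add: MDA_Weibull_def tail_regularly_varying_at_1_def F_eq)
    have P1: "tail (cdf P) 1 = 0"
      by (rule P.tail_at_upper_endpoint) (use r in \<open>simp add: F_eq one_ereal_def\<close>)
    define c where "c = Gamma (\<gamma> + 1) * Gamma (a + 1) / Gamma (\<gamma> + a + 1)"
    have Gamma_pos: "0 < Gamma (\<gamma> + 1)" "0 < Gamma (\<gamma> + a + 1)"
      using \<gamma> a by (auto intro!: Gamma_real_pos)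
    have c: "0 < c" using Gamma_pos Gamma_a by (simp add: c_def)
    have lim: "((\<lambda>u. (\<integral>t. tail (cdf P) (u / t) \<partial>Q) / (tail (cdf P) u * tail (cdf Q) u)) \<longlongrightarrow> c) (at_left 1)"
      unfolding c_def
      by (rule P.product_tail_regularly_varying[OF rvP \<gamma> P1 Q.real_distribution_axioms supp rv a])
    have "((\<lambda>u. (\<integral>t. tail (cdf P) (u / t) \<partial>Q) / (tail (cdf P) u * tail (cdf Q) u) / c *
        (tail (cdf Q) u / (\<pi> u / Gamma (a + 1)))) \<longlongrightarrow> c / c * 1) (at_left 1)"
      using c by (intro tendsto_mult tendsto_divide lim tendsto_const Q_lim) auto
    moreover have "eventually (\<lambda>u. (\<integral>t. tail (cdf P) (u / t) \<partial>Q) / (tail (cdf P) u * tail (cdf Q) u) / c *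
        (tail (cdf Q) u / (\<pi> u / Gamma (a + 1))) = measure M {\<omega> \<in> space M. X \<omega> > u} /
        (Gamma (\<gamma> + 1) / Gamma (\<gamma> + a + 1) * \<pi> u * tail F u)) (at_left 1)"
      using Q_pos
      by eventually_elim (use Gamma_a Gamma_pos in \<open>simp add: X_tail F_eq c_def\<close>)
    ultimately show ?thesis
      using c by (auto intro: Lim_transform_eventually)
  qed
  show ?thesis
    using part_a part_a1 part_b unfolding \<pi>_def a_def by blast
qed

end
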